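(* Let $G\subset \mathrm{Cr}_2(\mathbf{Q})$ be the subgroup generated by $\{s_1,\alpha_1,\mu_X\}$. Then the finitely generated group $G$ is solvable of length three (its derived length is exactly three), and $G$ is not linear over any field.
   Context: For a field $K$, the planar Cremona group $\mathrm{Cr}_2(K)$ is the group (under composition) of birational transformations of the 2-dimensional affine space over $K$, equivalently the group of $K$-automorphisms of the field of rational functions $K(t_1,t_2)$. For $f\in K(X)$ and $g\in K(X)^\times$, define $\alpha_f,\mu_g\in\mathrm{Cr}_2(K)$ by $\alpha_f(x,y)=(x,y+f(x))$ and $\mu_g(x,y)=(x,y\,g(x))$; for $t\in K$, define $s_t\in\mathrm{Cr}_2(K)$ by $s_t(x,y)=(x+t,y)$. Thus here, with $K=\mathbf{Q}$, $s_1(x,y)=(x+1,y)$, $\alpha_1(x,y)=(x,y+1)$ and $\mu_X(x,y)=(x,xy)$. A group is linear over a field $F$ if it admits an injective homomorphism into $\mathrm{GL}_d(F)$ for some finite $d$. *)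

theory Defs
  imports
    "HOL-Algebra.Solvable_Groups"
    "HOL-Computational_Algebra.Polynomial_Factorial"
    "Jordan_Normal_Form.Char_Poly"
begin

section \<open>The planar Cremona group\<close>

text \<open>The field \<open>K(t\<^sub>1,t\<^sub>2)\<close> is realised as \<open>K(t\<^sub>1)(t\<^sub>2)\<close>.\<close>

type_synonym 'a ratfun = "'a poly fract"
type_synonym 'a ratfun2 = "'a poly fract poly fract"

definition const2 :: "'a::field \<Rightarrow> 'a ratfun2"
  where "const2 c = to_fract [:to_fract [:c:]:]"

definition t1 :: "'a::field ratfun2"
  where "t1 = to_fract [:to_fract [:0, 1:]:]"

definition t2 :: "'a::field ratfun2"
  where "t2 = to_fract [:0, 1:]"

text \<open>
  A birational transformation \<open>u\<close> of the affine plane is represented by its comorphism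
  \<open>r \<mapsto> r \<circ> u\<close>, a \<open>K\<close>-automorphism of \<open>K(t\<^sub>1,t\<^sub>2)\<close> (\<^locale>\<open>field_hom\<close> is the locale of field
  homomorphisms). Since \<open>r \<circ> (u \<circ> v) = (r \<circ> u) \<circ> v\<close>, composition of
  transformations corresponds to composition of comorphisms in the opposite order; hence the
  reversal in the product below.
\<close>

definition Cr2 :: "('a::field ratfun2 \<Rightarrow> 'a ratfun2) monoid"
  where "Cr2 = \<lparr>carrier = {\<phi>. field_hom \<phi> \<and> bij \<phi> \<and> (\<forall>c. \<phi> (const2 c) = const2 c)},
                Group.monoid.mult = (\<lambda>\<phi> \<psi>. \<psi> \<circ> \<phi>),
                one = id\<rparr>"

text \<open>
  Extension of an injective ring homomorphism \<open>h\<close> to the field of fractions; the value is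
  unspecified when \<open>h\<close> is not injective.
\<close>

definition fract_lift :: "('b::idom \<Rightarrow> 'c::field) \<Rightarrow> 'b fract \<Rightarrow> 'c"
  where "fract_lift h r = (THE s. \<exists>p q. q \<noteq> 0 \<and> r = Fract p q \<and> s = h p / h q)"

text \<open>
  \<open>eval1 a f\<close> is \<open>f(a)\<close> for \<open>f \<in> K(X)\<close>, and \<open>birat a b r\<close> is \<open>r(a,b)\<close>. Thus \<open>birat a b\<close> is
  (the comorphism of) the transformation \<open>(x,y) \<mapsto> (a(x,y), b(x,y))\<close>, provided that
  \<open>a, b\<close> are algebraically independent over \<open>K\<close>.
\<close>

definition eval1 :: "'a::field ratfun2 \<Rightarrow> 'a ratfun \<Rightarrow> 'a ratfun2"
  where "eval1 a = fract_lift (\<lambda>p. eval_poly const2 p a)"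

definition birat :: "'a::field ratfun2 \<Rightarrow> 'a ratfun2 \<Rightarrow> 'a ratfun2 \<Rightarrow> 'a ratfun2"
  where "birat a b = fract_lift (\<lambda>p. eval_poly (eval1 a) p b)"

definition alpha :: "'a::field ratfun \<Rightarrow> 'a ratfun2 \<Rightarrow> 'a ratfun2"
  where "alpha f = birat t1 (t2 + eval1 t1 f)"

definition mu :: "'a::field ratfun \<Rightarrow> 'a ratfun2 \<Rightarrow> 'a ratfun2"
  where "mu g = birat t1 (t2 * eval1 t1 g)"

definition shift :: "'a::field \<Rightarrow> 'a ratfun2 \<Rightarrow> 'a ratfun2"
  where "shift t = birat (t1 + const2 t) t2"


section \<open>Derived length and linearity\<close>

definition finitely_generated :: "('g, 'm) monoid_scheme \<Rightarrow> bool"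
  where "finitely_generated G \<longleftrightarrow>
    (\<exists>S. finite S \<and> S \<subseteq> carrier G \<and> generate G S = carrier G)"

text \<open>Only meaningful for solvable \<open>G\<close>.\<close>

definition derived_length :: "('g, 'm) monoid_scheme \<Rightarrow> nat"
  where "derived_length G = (LEAST n. (derived G ^^ n) (carrier G) = {\<one>\<^bsub>G\<^esub>})"

definition GL :: "'f::field itself \<Rightarrow> nat \<Rightarrow> 'f mat monoid"
  where "GL F d = units_of (ring_mat F d ())"

definition linear_over :: "'f::field itself \<Rightarrow> ('g, 'm) monoid_scheme \<Rightarrow> bool"
  where "linear_over F G \<longleftrightarrow> (\<exists>d. \<exists>h \<in> hom G (GL F d). inj_on h (carrier G))"


section \<open>The transformations above are elements of the Cremona group\<close>

lemma group_Cr2: "group (Cr2 :: ('a::field ratfun2 \<Rightarrow> 'a ratfun2) monoid)"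
proof (rule groupI)
  fix \<phi> \<psi> :: "'a ratfun2 \<Rightarrow> 'a ratfun2"
  assume a: "\<phi> \<in> carrier Cr2" and b: "\<psi> \<in> carrier Cr2"
  interpret f: field_hom \<phi> using a by (simp add: Cr2_def)
  interpret g: field_hom \<psi> using b by (simp add: Cr2_def)
  have "field_hom (\<psi> \<circ> \<phi>)" by unfold_locales (simp_all add: f.hom_add g.hom_add f.hom_mult g.hom_mult)
  with a b show "\<phi> \<otimes>\<^bsub>Cr2\<^esub> \<psi> \<in> carrier Cr2"
    by (simp add: Cr2_def bij_comp)
next
  show "\<one>\<^bsub>Cr2\<^esub> \<in> (carrier Cr2 :: ('a ratfun2 \<Rightarrow> 'a ratfun2) set)"
    by (simp add: Cr2_def) (unfold_locales, auto)
next
  fix \<phi> :: "'a ratfun2 \<Rightarrow> 'a ratfun2"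
  assume a: "\<phi> \<in> carrier Cr2"
  interpret f: field_hom \<phi> using a by (simp add: Cr2_def)
  have bij: "bij \<phi>" using a by (simp add: Cr2_def)
  then have inj: "inj \<phi>" and i: "\<And>x. \<phi> (inv_into UNIV \<phi> x) = x" "\<And>x. inv_into UNIV \<phi> (\<phi> x) = x"
    by (auto simp: bij_def surj_f_inv_f)
  have "field_hom (inv_into UNIV \<phi>)"
    by unfold_locales (rule injD[OF inj], simp add: i f.hom_add f.hom_mult)+
  moreover have "inv_into UNIV \<phi> (const2 c) = const2 c" for c
    using a i(2)[of "const2 c"] by (simp add: Cr2_def)
  ultimately have "inv_into UNIV \<phi> \<in> carrier Cr2" using bij
    by (simp add: Cr2_def bij_imp_bij_inv)
  moreover have "inv_into UNIV \<phi> \<otimes>\<^bsub>Cr2\<^esub> \<phi> = \<one>\<^bsub>Cr2\<^esub>"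
    by (auto simp: Cr2_def i)
  ultimately show "\<exists>\<psi>\<in>carrier Cr2. \<psi> \<otimes>\<^bsub>Cr2\<^esub> \<phi> = \<one>\<^bsub>Cr2\<^esub>" by blast
qed (simp_all add: Cr2_def o_assoc)

locale embedding = idom_hom h for h :: "'b::idom \<Rightarrow> 'c::field" +
  assumes ker: "h p = 0 \<Longrightarrow> p = 0"
begin

lemma fract_lift_Fract:
  assumes "q \<noteq> 0" shows "fract_lift h (Fract p q) = h p / h q"
  unfolding fract_lift_def
proof (rule the_equality)
  fix s assume "\<exists>p' q'. q' \<noteq> 0 \<and> Fract p q = Fract p' q' \<and> s = h p' / h q'"
  then obtain p' q' where q': "q' \<noteq> 0" and e: "p * q' = p' * q" and s: "s = h p' / h q'"
    using assms by (auto simp: eq_fract)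
  have "h p * h q' = h p' * h q" by (metis e hom_mult)
  moreover have "h q \<noteq> 0" "h q' \<noteq> 0" using ker assms q' by blast+
  ultimately show "s = h p / h q" by (simp add: s field_simps)
qed (use assms in blast)

lemma fract_lift_to_fract: "fract_lift h (to_fract p) = h p"
  by (simp add: to_fract_def fract_lift_Fract)

lemma field_hom_fract_lift: "field_hom (fract_lift h)"
proof
  show "fract_lift h 0 = 0" "fract_lift h 1 = 1"
    using fract_lift_to_fract[of 0] fract_lift_to_fract[of 1] by simp_all
  fix x y :: "'b fract"
  obtain p q where x: "x = Fract p q" "q \<noteq> 0" by (cases x)
  obtain p' q' where y: "y = Fract p' q'" "q' \<noteq> 0" by (cases y)
  have n: "h q \<noteq> 0" "h q' \<noteq> 0" using ker x y by blast+
  show "fract_lift h (x + y) = fract_lift h x + fract_lift h y"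
    "fract_lift h (x * y) = fract_lift h x * fract_lift h y"
    using x y n by (simp_all add: fract_lift_Fract hom_add hom_mult field_simps)
qed

end

lemma eval_poly_pCons_hom:
  "f 0 = 0 \<Longrightarrow> eval_poly f (pCons c p) x = f c + x * eval_poly f p x"
  unfolding eval_poly_def by (subst Polynomial.map_poly_pCons) simp_all

lemma idom_hom_eval_poly:
  assumes "idom_hom f" shows "idom_hom (\<lambda>p. eval_poly f p (a::'c::idom))"
proof -
  interpret f: idom_hom f by fact
  interpret m: map_poly_comm_ring_hom f ..
  show ?thesis
    by unfold_locales (simp_all add: eval_poly_def m.hom_add m.hom_mult)
qed

lemma to_fract_divide: "q \<noteq> 0 \<Longrightarrow> Fract p q = to_fract p / to_fract (q :: 'b::idom)"
  by (simp add: to_fract_def)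

lemma to_fract_const_divide:
  "y \<noteq> 0 \<Longrightarrow> to_fract [:x:] / to_fract [:y:] = (to_fract [:x / y:] :: 'b::field poly fract)"
  by (simp add: to_fract_def eq_fract)

lemma idom_hom_const2: "idom_hom const2"
  by unfold_locales
    (simp_all add: const2_def to_fract_def One_fract_def Zero_fract_def one_pCons eq_fract)

context
  fixes t :: "'a::field"
begin

lemma eval_poly_const2_shift:
  "eval_poly const2 p (t1 + const2 t) = to_fract [:to_fract (pcompose p [:t, 1:]):]"
proof (induction p)
  case (pCons c p)
  have "const2 (0::'a) = 0" by (simp add: const2_def)
  then show ?case using pCons
    by (simp add: eval_poly_pCons_hom pcompose_pCons t1_def const2_def to_fract_def algebra_simps)
qed (simp add: eval_poly_def)

lemma embedding1: "embedding (\<lambda>p. eval_poly const2 p (t1 + const2 t))"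
proof -
  interpret h: idom_hom "\<lambda>p. eval_poly const2 p (t1 + const2 t)"
    by (intro idom_hom_eval_poly idom_hom_const2)
  show ?thesis
    by unfold_locales (auto simp: eval_poly_const2_shift pcompose_eq_0_iff)
qed

interpretation e1: embedding "\<lambda>p. eval_poly const2 p (t1 + const2 t)" by (rule embedding1)

interpretation s: field_hom "eval1 (t1 + const2 t)"
  unfolding eval1_def by (rule e1.field_hom_fract_lift)

lemma eval1_base: "\<exists>r'. eval1 (t1 + const2 t) r = to_fract [:r':]"
proof (cases r)
  case (Fract p q)
  then have "eval1 (t1 + const2 t) r
      = to_fract [:to_fract (pcompose p [:t, 1:]) / to_fract (pcompose q [:t, 1:]):]"
    unfolding eval1_def Fract(1) e1.fract_lift_Fract[OF Fract(2)]
    unfolding eval_poly_const2_shift by (intro to_fract_const_divide) (simp add: pcompose_eq_0_iff Fract(2))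
  then show ?thesis ..
qed

lemma embedding2:
  assumes "g \<noteq> 0"
  shows "embedding (\<lambda>p. eval_poly (eval1 (t1 + const2 t)) p (to_fract [:f, g:]))"
proof -
  let ?s = "eval1 (t1 + const2 t)"
  obtain \<tau> where \<tau>: "\<And>r. ?s r = to_fract [:\<tau> r:]" using eval1_base by metis
  have \<tau>0: "\<tau> r = 0 \<longleftrightarrow> r = 0" for r
  proof -
    have "?s r = 0 \<longleftrightarrow> r = 0"
      by (metis s.hom_inverse s.hom_mult s.hom_one s.hom_zero right_inverse mult_zero_left zero_neq_one)
    then show ?thesis by (simp add: \<tau>)
  qed
  have e: "eval_poly ?s p (to_fract [:f, g:]) = to_fract (pcompose (map_poly \<tau> p) [:f, g:])" for p
  proof (induction p)
    case (pCons c p)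
    then show ?case
      by (simp add: eval_poly_pCons_hom pcompose_pCons Polynomial.map_poly_pCons \<tau>0 s.hom_zero)
        (simp add: \<tau> to_fract_def)
  qed (simp add: eval_poly_def)
  interpret h: idom_hom "\<lambda>p. eval_poly ?s p (to_fract [:f, g:])"
    by (intro idom_hom_eval_poly) unfold_locales
  show ?thesis
    using assms by unfold_locales (auto simp: e pcompose_eq_0_iff map_poly_eq_0_iff \<tau>0)
qed

end

lemma field_hom_inj:
  assumes "field_hom \<phi>" shows "inj \<phi>"
proof (rule injI, rule ccontr)
  interpret field_hom \<phi> by fact
  fix x y assume "\<phi> x = \<phi> y" "x \<noteq> y"
  then have "\<phi> (x - y) = 0" "(x - y) * inverse (x - y) = 1" by (simp_all add: hom_minus)
  then show False using hom_mult[of "x - y" "inverse (x - y)"] by simp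
qed

lemma field_hom_surjI:
  fixes \<phi> :: "'a::field ratfun2 \<Rightarrow> 'a ratfun2"
  assumes "field_hom \<phi>" and c: "\<And>c. \<phi> (const2 c) = const2 c" and 1: "t1 \<in> range \<phi>"
    and 2: "(\<And>r. to_fract [:r:] \<in> range \<phi>) \<Longrightarrow> t2 \<in> range \<phi>"
  shows "surj \<phi>"
proof -
  interpret field_hom \<phi> by fact
  have add: "x + y \<in> range \<phi>" if "x \<in> range \<phi>" "y \<in> range \<phi>" for x y
    using that by (elim rangeE) (simp flip: hom_add)
  have mul: "x * y \<in> range \<phi>" if "x \<in> range \<phi>" "y \<in> range \<phi>" for x y
    using that by (elim rangeE) (simp flip: hom_mult)
  have dvd: "x / y \<in> range \<phi>" if "x \<in> range \<phi>" "y \<in> range \<phi>" for x y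
    using that by (elim rangeE) (simp flip: hom_div)
  have A: "to_fract [:to_fract p:] \<in> range \<phi>" for p :: "'a poly"
  proof (induction p)
    case 0 then show ?case by (metis hom_zero pCons_0_0 rangeI to_fract_0)
  next
    case (pCons a p)
    have "to_fract [:to_fract (pCons a p):] = const2 a + t1 * to_fract [:to_fract p:]"
      by (simp add: const2_def t1_def to_fract_def)
    then show ?case using add mul 1 pCons c by (metis rangeI)
  qed
  have B: "to_fract [:r:] \<in> range \<phi>" for r :: "'a ratfun"
  proof (cases r)
    case (Fract p q)
    then have "to_fract [:r:] = to_fract [:to_fract p:] / to_fract [:to_fract q:]"
      by (simp add: to_fract_divide to_fract_const_divide)
    then show ?thesis using dvd A by metis
  qed
  have C: "to_fract p \<in> range \<phi>" for p :: "'a ratfun poly"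
  proof (induction p)
    case 0 then show ?case by (metis hom_zero rangeI to_fract_0)
  next
    case (pCons a p)
    have "to_fract (pCons a p) = to_fract [:a:] + t2 * to_fract p"
      by (simp add: t2_def to_fract_def)
    then show ?case using add mul 2 B pCons by metis
  qed
  have "r \<in> range \<phi>" for r
    by (cases r) (use dvd C to_fract_divide in metis)
  then show ?thesis by blast
qed

lemma birat_mem_Cr2:
  fixes t :: "'a::field"
  assumes g: "g \<noteq> 0"
  shows "birat (t1 + const2 t) (to_fract [:f, g:]) \<in> carrier Cr2"
proof -
  let ?a = "t1 + const2 t" and ?b = "to_fract [:f, g:]"
  interpret e1: embedding "\<lambda>p. eval_poly const2 p ?a" by (rule embedding1)
  interpret s: field_hom "eval1 ?a"
    unfolding eval1_def by (rule e1.field_hom_fract_lift)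
  interpret e2: embedding "\<lambda>p. eval_poly (eval1 ?a) p ?b" by (rule embedding2[OF g])
  interpret b: field_hom "birat ?a ?b"
    unfolding birat_def by (rule e2.field_hom_fract_lift)
  have c: "birat ?a ?b (to_fract [:r:]) = eval1 ?a r" for r
    by (simp add: birat_def e2.fract_lift_to_fract eval_poly_pCons_hom)
  have e: "eval1 ?a (to_fract p) = to_fract [:to_fract (pcompose p [:t, 1:]):]" for p
    unfolding eval1_def e1.fract_lift_to_fract by (rule eval_poly_const2_shift)
  have cc: "birat ?a ?b (const2 c) = const2 c" for c
    using c[of "to_fract [:c:]"] unfolding e by (simp flip: const2_def)
  have bt1: "birat ?a ?b t1 = ?a"
    using c[of "to_fract [:0, 1:]"] unfolding e
    by (simp add: pcompose_pCons flip: t1_def)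
      (simp add: t1_def const2_def to_fract_def)
  have bt2: "birat ?a ?b t2 = ?b"
    by (simp add: t2_def birat_def e2.fract_lift_to_fract eval_poly_pCons_hom)
  have "inj (birat ?a ?b)"
    by (rule field_hom_inj) unfold_locales
  moreover have "surj (birat ?a ?b)"
  proof (rule field_hom_surjI[OF b.field_hom_axioms cc])
    have "t1 = birat ?a ?b (t1 - const2 t)" by (simp add: b.hom_minus bt1 cc)
    then show "t1 \<in> range (birat ?a ?b)" by blast
    assume B: "to_fract [:r:] \<in> range (birat ?a ?b)" for r
    have "t2 = (?b - to_fract [:f:]) / to_fract [:g:]"
      using g by (simp add: t2_def to_fract_def eq_fract)
    moreover obtain x y where "to_fract [:f:] = birat ?a ?b x" "to_fract [:g:] = birat ?a ?b y"
      using B[of f] B[of g] by blast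
    ultimately have "t2 = birat ?a ?b ((t2 - x) / y)"
      by (simp only: b.hom_minus b.hom_div bt2)
    then show "t2 \<in> range (birat ?a ?b)" by blast
  qed
  ultimately show ?thesis
    by (simp add: Cr2_def bij_def b.field_hom_axioms cc)
qed

lemma eval1_t1: "eval1 t1 r = to_fract [:r:]"
proof (cases r)
  case (Fract p q)
  have z: "const2 (0::'a) = 0" by (simp add: const2_def)
  interpret e1: embedding "\<lambda>p. eval_poly const2 p (t1 :: 'a ratfun2)"
    using embedding1[of "0::'a"] by (simp add: z)
  have "eval_poly const2 p t1 = to_fract [:to_fract p:]" for p :: "'a poly"
    using eval_poly_const2_shift[of p 0] by (simp add: z)
  then show ?thesis
    unfolding eval1_def Fract(1) e1.fract_lift_Fract[OF Fract(2)]
    using Fract(2) by (simp add: to_fract_divide to_fract_const_divide)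
qed

lemma alpha_mem_Cr2: "alpha f \<in> carrier Cr2"
  using birat_mem_Cr2[of 1 0 f]
  by (simp add: alpha_def eval1_t1 t2_def const2_def flip: to_fract_add)

lemma mu_mem_Cr2: "g \<noteq> 0 \<Longrightarrow> mu g \<in> carrier Cr2"
  using birat_mem_Cr2[of g 0 0]
  by (simp add: mu_def eval1_t1 t2_def const2_def flip: to_fract_mult)

lemma shift_mem_Cr2: "shift t \<in> carrier Cr2"
  using birat_mem_Cr2[of 1 t 0] by (simp add: shift_def t2_def)

end

theory Submission
  imports Defs
begin

text \<open>
  Write \<open>A\<^sub>f\<close> for the image of \<open>\<alpha>\<^sub>f\<close> under a \<open>d\<close>-dimensional representation, \<open>f \<in> \<nat>[X]\<close>.
  Conjugation by \<open>s\<^sub>1\<close> and \<open>\<mu>\<^sub>X\<close> realises \<open>f \<mapsto> f(X + 1)\<close> and \<open>f \<mapsto> X f\<close> on the \<open>A\<^sub>f\<close>.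
  Since \<open>A\<^sub>1\<close> is the commutator of \<open>A\<^sub>X\<close> and \<open>s\<^sub>1\<close> and commutes with both, a power \<open>A\<^sub>c\<close> of it is
  unipotent. In positive characteristic \<open>A\<^sub>c\<close> then has finite order. In characteristic zero all
  \<open>N\<^sub>f = A\<^bsub>c f\<^esub> - 1\<close> are nilpotent. If they did not vanish, multiplication by a suitable product of
  them would make \<open>N\<close> additive but not zero. The linear images of \<open>N\<close> which are additive form a
  finite-dimensional space of functions on \<open>\<nat>[X]\<close>, stable under \<open>f \<mapsto> f(X + 1)\<close> and \<open>f \<mapsto> X f\<close>;
  its annihilator in \<open>F[X]\<close> is nonzero and stable under \<open>X \<mapsto> X + 1\<close>, so it contains a nonzero
  constant and the space is zero. Either way \<open>\<alpha>\<close> is not represented faithfully.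

  For the derived length, the three successive quotients of the derived series embed in the shifts
  of \<open>x\<close>, the dilations of \<open>y\<close> and the translations of \<open>y\<close>; and \<open>\<mu>\<^bsub>(X+1)/X\<^esub>\<close>, \<open>\<alpha>\<^bsub>X-1\<^esub>\<close> are
  noncommuting commutators.
\<close>

section \<open>Polynomials evaluated in a noncommutative ring\<close>

text \<open>Terms beyond the degree vanish because an additive \<open>g i\<close> sends 0 to 0. The
  common range \<open>n\<close> lets sums attached to polynomials of different degree be compared;
  \<open>eval_ring\<close>, \<open>lin_ext\<close> and the functionals on relations all rely on
  this.\<close>

lemma sum_coeff_bound:
  fixes g :: "nat \<Rightarrow> 'a::comm_monoid_add \<Rightarrow> 'b::ab_group_add"
  assumes "\<And>i a b. g i (a + b) = g i a + g i b" and "degree p \<le> n"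
  shows "(\<Sum>i\<le>degree p. g i (coeff p i)) = (\<Sum>i\<le>n. g i (coeff p i))"
proof (rule sum.mono_neutral_left)
  have "g i 0 = 0" for i using assms(1)[of i 0 0] by simp
  then show "\<forall>i\<in>{..n} - {..degree p}. g i (coeff p i) = 0" by (auto simp: coeff_eq_0)
qed (use assms in auto)

lemma sum_coeff_add:
  fixes g :: "nat \<Rightarrow> 'a::comm_monoid_add \<Rightarrow> 'b::ab_group_add"
  assumes g: "\<And>i a b. g i (a + b) = g i a + g i b"
  shows "(\<Sum>i\<le>degree (p + q). g i (coeff (p + q) i))
    = (\<Sum>i\<le>degree p. g i (coeff p i)) + (\<Sum>i\<le>degree q. g i (coeff q i))"
proof -
  let ?n = "max (degree p) (degree q)"
  note bound = sum_coeff_bound[of g, OF g]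
  show ?thesis
    unfolding bound[OF degree_add_le_max] bound[of p ?n, OF max.cobounded1] bound[of q ?n, OF max.cobounded2]
    by (simp add: g sum.distrib)
qed

lemma sum_coeff_pCons:
  fixes g :: "nat \<Rightarrow> 'a::comm_monoid_add \<Rightarrow> 'b::ab_group_add"
  assumes g: "\<And>i a b. g i (a + b) = g i a + g i b"
  shows "(\<Sum>i\<le>degree (pCons a p). g i (coeff (pCons a p) i))
    = g 0 a + (\<Sum>i\<le>degree p. g (Suc i) (coeff p i))"
  using g[of _ 0 0]
  by (simp add: sum_coeff_bound[of g _ "Suc (degree p)", OF g] degree_pCons_le sum.atMost_Suc_shift
      del: sum.atMost_Suc)

text \<open>Integer coefficients are central in every ring, so evaluation at \<open>z\<close> is a
  ring homomorphism even when \<open>'r\<close> is not commutative. Identities and divisibilities in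
  the commutative ring of integer polynomials can thus be transported to powers of
  \<open>z\<close>.\<close>

definition eval_ring :: "'r::ring_1 \<Rightarrow> int poly \<Rightarrow> 'r"
  where "eval_ring z p = (\<Sum>i\<le>degree p. of_int (coeff p i) * z ^ i)"

lemma eval_ring_add: "eval_ring z (p + q) = eval_ring z p + eval_ring z q"
  unfolding eval_ring_def by (rule sum_coeff_add) (simp add: distrib_right)

lemma of_int_left_commute: "z * (of_int a * w) = of_int a * (z * w)" for z :: "'r::ring_1"
  by (metis mult.assoc mult_of_int_commute)

lemma eval_ring_pCons: "eval_ring z (pCons a p) = of_int a + z * eval_ring z p"
proof -
  have "eval_ring z (pCons a p) = of_int a * z ^ 0 + (\<Sum>i\<le>degree p. of_int (coeff p i) * z ^ Suc i)"
    unfolding eval_ring_def by (rule sum_coeff_pCons) (simp add: distrib_right)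
  then show ?thesis by (simp add: eval_ring_def sum_distrib_left of_int_left_commute)
qed

lemma eval_ring_0: "eval_ring z 0 = 0" by (simp add: eval_ring_def)

lemma eval_ring_smult: "eval_ring z (Polynomial.smult a p) = of_int a * eval_ring z p"
  proof (induction p)
  case (pCons b p)
  then show ?case
    by (simp add: eval_ring_pCons distrib_left of_int_left_commute)
qed (simp add: eval_ring_0)

lemma eval_ring_mult: "eval_ring z (p * q) = eval_ring z p * eval_ring z q"
proof (induction p)
  case (pCons a p)
  then show ?case by (simp add: eval_ring_add eval_ring_smult eval_ring_pCons distrib_right mult.assoc)
qed (simp add: eval_ring_0)

lemma eval_ring_1: "eval_ring z 1 = 1" by (simp add: eval_ring_def)

lemma eval_ring_power: "eval_ring z (p ^ n) = eval_ring z p ^ n"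
  by (induction n) (simp_all add: eval_ring_1 eval_ring_mult)

lemma eval_ring_monom: "eval_ring z (monom 1 n) = z ^ n"
proof (induction n)
  case 0 then show ?case by (simp add: eval_ring_1 flip: one_pCons)
next
  case (Suc n) then show ?case by (simp add: monom_Suc eval_ring_pCons power_commutes)
qed

lemma eval_ring_diff: "eval_ring z (p - q) = eval_ring z p - eval_ring z q"
  using eval_ring_add[of z "p - q" q] by (simp add: algebra_simps)

text \<open>Modulo (X - 1)^2 the polynomial X^p - 1 equals p (X - 1), and p vanishes in the ring, so
  z^p - 1 is a multiple of (z - 1)^2. Passing from z to z^p therefore lowers the nilpotency
  exponent.\<close>

lemma unipotent_torsion:
  fixes z :: "'r::ring_1"
  assumes p: "of_nat p = (0::'r)" "p > 0" and "(z - 1) ^ n = 0"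
  shows "\<exists>k>0. z ^ k = 1"
  using assms(3)
proof (induction n arbitrary: z)
  case 0
  then have "(1::'r) = 0" by simp
  then have "z = 1" by (metis mult_1_left mult_zero_left)
  then show ?case by auto
next
  case (Suc n)
  show ?case
  proof (cases "n = 0")
    case True
    then show ?thesis using Suc by (intro exI[of _ 1]) simp
  next
    case False
    let ?X = "monom 1 1 :: int poly"
    have "\<exists>r. ?X ^ k - 1 = of_nat k * (?X - 1) + r * (?X - 1)\<^sup>2" for k
    proof (induction k)
      case 0 then show ?case by (intro exI[of _ 0]) simp
    next
      case (Suc k)
      then obtain r where r: "?X ^ k - 1 = of_nat k * (?X - 1) + r * (?X - 1)\<^sup>2" ..
      have "?X ^ Suc k - 1 = ?X * (?X ^ k - 1) + (?X - 1)" by (simp add: algebra_simps)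
      also have "\<dots> = of_nat (Suc k) * (?X - 1) + (of_nat k + ?X * r) * (?X - 1)\<^sup>2"
        unfolding r by (simp add: algebra_simps power2_eq_square)
      finally show ?case by blast
    qed
    then obtain r where r: "?X ^ p - 1 = of_nat p * (?X - 1) + r * (?X - 1)\<^sup>2" by blast
    have p0: "eval_ring z (of_nat p) = 0"
      using p by (simp add: of_nat_poly eval_ring_pCons eval_ring_0)
    have X: "eval_ring z ?X = z" using eval_ring_monom[of z 1] by (simp only: power_one_right)
    have e: "z ^ p - 1 = eval_ring z (r * (?X - 1)\<^sup>2)"
      using arg_cong[OF r, of "eval_ring z"]
      by (simp only: eval_ring_diff eval_ring_add eval_ring_mult eval_ring_power eval_ring_1 p0 X mult_zero_left add_0_left)
    \<comment> \<open>The n-th power of (X - 1)^2 contains (X - 1)^(n + 1) only for positive n; for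
      n = 0 the hypothesis already gives z = 1.\<close>
    have "2 * n = (n - 1) + Suc n" using False by simp
    then have "(r * (?X - 1)\<^sup>2) ^ n = (r ^ n * (?X - 1) ^ (n - 1)) * (?X - 1) ^ Suc n"
      by (simp only: power_mult_distrib power_mult[symmetric] power_add mult.assoc)
    then have "(z ^ p - 1) ^ n = eval_ring z (r ^ n * (?X - 1) ^ (n - 1)) * (z - 1) ^ Suc n"
      unfolding e eval_ring_power[symmetric] by (simp only: eval_ring_mult eval_ring_power eval_ring_diff eval_ring_1 X)
    then have "(z ^ p - 1) ^ n = 0" using Suc.prems by simp
    from Suc.IH[OF this] obtain k where "k > 0" "(z ^ p) ^ k = 1" by blast
    then show ?thesis using p by (intro exI[of _ "p * k"]) (simp add: power_mult)
  qed
qed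

text \<open>Generalised to \<open>a ^ i * b ^ j * (a + b) ^ n\<close> with \<open>i + j + n\<close>
  at least \<open>k + l\<close>: each factor a + b raises one of the exponents i, j, and when n = 0
  one of them has reached its bound.\<close>

lemma nilpotent_add:
  fixes a b :: "'r::ring_1"
  assumes "a ^ k = 0" "b ^ l = 0" and c: "a * b = b * a"
  shows "(a + b) ^ (k + l) = 0"
proof -
  have c': "a * b ^ j = b ^ j * a" for j
    using power_commuting_commutes[OF c[symmetric], of j] by simp
  have 0: "a ^ i = 0" if "i \<ge> k" for i
    using that assms(1) by (metis le_add_diff_inverse mult_zero_left power_add)
  have 1: "b ^ i = 0" if "i \<ge> l" for i
    using that assms(2) by (metis le_add_diff_inverse mult_zero_left power_add)
  have "a ^ i * b ^ j * (a + b) ^ n = 0" if "i + j + n \<ge> k + l" for i j n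
    using that
  proof (induction n arbitrary: i j)
    case 0
    then have "i \<ge> k \<or> j \<ge> l" by linarith
    then show ?case using 0 1 \<open>\<And>i. i \<ge> k \<Longrightarrow> a ^ i = 0\<close> by auto
  next
    case (Suc n)
    have 1: "a ^ i * b ^ j * a = a ^ Suc i * b ^ j"
      by (simp only: mult.assoc c'[symmetric] power_Suc2)
    have 2: "a ^ i * b ^ j * b = a ^ i * b ^ Suc j"
      by (simp only: mult.assoc power_Suc2)
    have "a ^ i * b ^ j * (a + b) ^ Suc n = (a ^ i * b ^ j * a + a ^ i * b ^ j * b) * (a + b) ^ n"
      by (simp only: power_Suc distrib_left flip: mult.assoc)
    then have "a ^ i * b ^ j * (a + b) ^ Suc n
        = a ^ Suc i * b ^ j * (a + b) ^ n + a ^ i * b ^ Suc j * (a + b) ^ n"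
      by (simp only: 1 2 distrib_right)
    also have "\<dots> = 0" using Suc.IH[of "Suc i" j] Suc.IH[of i "Suc j"] Suc.prems by simp
    finally show ?case .
  qed
  from this[of 0 0 "k + l"] show ?thesis by simp
qed

section \<open>Finite-dimensional subrings\<close>

lemma power_mult_commuting:
  fixes a b :: "'r::monoid_mult"
  assumes "a * b = b * a" shows "(a * b) ^ k = a ^ k * b ^ k"
proof (induction k)
  case (Suc k)
  have "a ^ k * b = b * a ^ k" by (rule power_commuting_commutes[OF assms])
  then have "b * (a ^ k * w) = a ^ k * (b * w)" for w by (metis mult.assoc)
  then show ?case using Suc by (simp add: mult.assoc)
qed simp

lemma left_inverse_power:
  fixes y :: "'r::monoid_mult"
  assumes "y * x = 1" shows "y ^ k * x ^ k = 1"
proof (induction k)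
  case (Suc k)
  have "y ^ Suc k * x ^ Suc k = y ^ k * (y * x) * x ^ k"
    by (simp only: power_Suc2[of y] power_Suc[of x] mult.assoc)
  then show ?case using Suc assms by simp
qed simp

lemma diff_one_dvd_power: "x - 1 dvd x ^ k - (1 :: 'a::comm_ring_1)"
  by (metis dvd_triv_left power_diff_1_eq)

text \<open>\<open>scal\<close> puts the field into the centre of the ring. Finite dimension of
  \<open>Q\<close> enters only through \<open>dependent\<close>: every sequence in \<open>Q\<close>
  satisfies a nontrivial linear relation, whose coefficients are stored in a polynomial. Conjugating
  elements may lie outside \<open>Q\<close>.\<close>

locale finite_dim_subring =
  fixes scal :: "'f::field \<Rightarrow> 'r::ring_1" and Q :: "'r set"
  assumes scal_add: "scal (a + b) = scal a + scal b"
    and scal_mult: "scal (a * b) = scal a * scal b"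
    and scal_1: "scal 1 = 1"
    and scal_commute: "scal a * r = r * scal a"
    and Q_1: "1 \<in> Q"
    and Q_diff: "x \<in> Q \<Longrightarrow> y \<in> Q \<Longrightarrow> x - y \<in> Q"
    and Q_mult: "x \<in> Q \<Longrightarrow> y \<in> Q \<Longrightarrow> x * y \<in> Q"
    and dependent: "(\<And>i. w i \<in> Q) \<Longrightarrow> \<exists>q\<noteq>0. (\<Sum>i\<le>degree q. scal (coeff q i) * w i) = 0"
begin

lemma Q_power: "x \<in> Q \<Longrightarrow> x ^ n \<in> Q"
  by (induction n) (auto intro: Q_1 Q_mult)

lemma scal_0: "scal 0 = 0"
  using scal_add[of 0 0] by simp

lemma scal_of_nat: "scal (of_nat n) = of_nat n"
  by (induction n) (simp_all add: scal_0 scal_add scal_1)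

lemma scal_inverse_cancel: "c \<noteq> 0 \<Longrightarrow> scal (inverse c) * (scal c * r) = r"
  by (simp add: scal_1 flip: mult.assoc scal_mult)

lemma scal_cancel: "c \<noteq> 0 \<Longrightarrow> scal c * r = 0 \<Longrightarrow> r = 0"
  by (metis scal_inverse_cancel mult_zero_right)

text \<open>A polynomial equation for \<open>x\<close> is also satisfied by its conjugates \<open>x z\<^sup>k\<close>; a Vandermonde
  elimination over all \<open>k\<close> isolates the leading term.\<close>
lemma heisenberg_quasi_unipotent:
  assumes x: "x \<in> Q" "y * x = 1" and z: "z' * z = 1" and s: "s * t = 1" "t * s = 1"
    and sx: "s * x * t = x * z" and sz: "s * z = z * s" and xz: "x * z = z * x"
  shows "\<exists>c>0. \<exists>n. (z ^ c - 1) ^ n = 0"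
proof -
  obtain q where q: "q \<noteq> 0" and q0: "(\<Sum>i\<le>degree q. scal (coeff q i) * x ^ i) = 0"
    using dependent[of "\<lambda>i. x ^ i"] Q_power[OF x(1)] by blast
  define n where "n = degree q"
  define a where "a i = scal (coeff q i) * x ^ i" for i
  let ?M = "\<lambda>i. monom 1 i :: int poly"
  have conj_mult: "s * (u * v) * t = (s * u * t) * (s * v * t)" for u v
    by (metis mult.assoc mult_1_left s(2))
  have conj_power: "s * u ^ k * t = (s * u * t) ^ k" for u k
  proof (induction k)
    case (Suc k)
    then show ?case by (simp only: power_Suc conj_mult)
  qed (simp add: s)
  have conj_z: "s * z * t = z" by (metis mult.assoc mult_1_right s(1) sz)
  have conj_scal: "s * scal c * t = scal c" for c
    by (metis mult.assoc mult_1_right s(1) scal_commute)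
  \<comment> \<open>Conjugation by \<open>s\<close> sends x to x z and fixes z and the scalars, so
    it multiplies the i-th term by \<open>z ^ i\<close>.\<close>
  have b: "(\<Sum>i\<le>n. a i * (z ^ i) ^ k) = 0" for k
  proof (induction k)
    case 0 then show ?case using q0 by (simp add: a_def n_def)
  next
    case (Suc k)
    have "s * (a i * (z ^ i) ^ k) * t = a i * (z ^ i) ^ Suc k" for i
      unfolding a_def conj_mult conj_power conj_z conj_scal sx power_mult_commuting[OF xz]
      by (simp only: mult.assoc power_Suc)
    then have "(\<Sum>i\<le>n. a i * (z ^ i) ^ Suc k) = s * (\<Sum>i\<le>n. a i * (z ^ i) ^ k) * t"
      by (simp only: sum_distrib_left sum_distrib_right)
    then show ?case using Suc by simp
  qed
  \<comment> \<open>Multiplying the i-th term by z^i - z^j amounts to subtracting z^j times one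
    conjugated relation from the next one, and it kills the term i = j. After n rounds only i = n is
    left.\<close>
  define P where "P j i = (\<Prod>l<j. ?M i - ?M l)" for i j :: nat
  have V: "(\<Sum>i\<le>n. a i * eval_ring z (P j i * ?M i ^ k)) = 0" for j k
  proof (induction j arbitrary: k)
    case 0
    then show ?case using b by (simp add: P_def eval_ring_power eval_ring_monom)
  next
    case (Suc j)
    have "P (Suc j) i * ?M i ^ k = P j i * ?M i ^ Suc k - (P j i * ?M i ^ k) * ?M j" for i
      by (simp add: P_def algebra_simps)
    then have "(\<Sum>i\<le>n. a i * eval_ring z (P (Suc j) i * ?M i ^ k))
        = (\<Sum>i\<le>n. a i * eval_ring z (P j i * ?M i ^ Suc k)) - (\<Sum>i\<le>n. a i * eval_ring z (P j i * ?M i ^ k)) * z ^ j"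
      by (simp only: eval_ring_diff right_diff_distrib sum_subtractf eval_ring_mult[of _ _ "?M j"] eval_ring_monom
          sum_distrib_right mult.assoc[of "_ :: 'r"])
    then show ?case using Suc[of "Suc k"] Suc[of k] by (simp only:) simp
  qed
  have "P n i = 0" if "i < n" for i using that by (auto simp: P_def)
  then have "(\<Sum>i\<le>n. a i * eval_ring z (P n i * ?M i ^ 0)) = a n * eval_ring z (P n n)"
    by (simp add: sum.remove[of _ n] eval_ring_0)
  then have "scal (coeff q n) * (x ^ n * eval_ring z (P n n)) = 0"
    using V[of n 0] by (simp add: a_def mult.assoc)
  moreover have "coeff q n \<noteq> 0" using q by (simp add: n_def)
  ultimately have "x ^ n * eval_ring z (P n n) = 0" by (rule scal_cancel[rotated])
  then have 0: "eval_ring z (P n n) = 0"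
    by (metis left_inverse_power[OF x(2)] mult.assoc mult_1_left mult_zero_right)
  \<comment> \<open>Every n - l with l < n divides n!, so all factors X^n - X^l are absorbed by X^n
    (X^(n!) - 1), which leads to the exponent \<open>fact n\<close>.\<close>
  have "P n n dvd (\<Prod>l<n. ?M n * (?M (fact n) - 1))"
    unfolding P_def
  proof (rule prod_dvd_prod)
    fix l assume "l \<in> {..<n}"
    then have l: "l < n" by simp
    have "n - l dvd fact n" using l by (intro dvd_fact) auto
    then obtain k where k: "fact n = (n - l) * k" by (rule dvdE)
    have 1: "?M n = ?M l * ?M (n - l)" using l by (simp add: mult_monom)
    have "?M (n - l) - 1 dvd ?M (fact n) - 1"
      unfolding k using diff_one_dvd_power[of "?M (n - l)" k] by (simp add: monom_power)
    then have "?M l * (?M (n - l) - 1) dvd ?M n * (?M (fact n) - 1)"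
      by (intro mult_dvd_mono) (auto simp: 1)
    then show "?M n - ?M l dvd ?M n * (?M (fact n) - 1)"
      by (simp add: 1 algebra_simps)
  qed
  then have "P n n dvd ?M n ^ n * (?M (fact n) - 1) ^ n"
    by (simp add: power_mult_distrib)
  then obtain r where "?M n ^ n * (?M (fact n) - 1) ^ n = P n n * r" by (rule dvdE)
  from arg_cong[OF this, of "eval_ring z"] have "(z ^ n) ^ n * (z ^ fact n - 1) ^ n = 0"
    by (simp only: eval_ring_mult eval_ring_power eval_ring_monom eval_ring_diff eval_ring_1 0 mult_zero_left)
  moreover have "z' ^ (n * n) * (z ^ n) ^ n = 1"
    using left_inverse_power[OF z, of "n * n"] by (simp only: power_mult)
  ultimately have "(z ^ fact n - 1) ^ n = 0"
    by (metis mult.assoc mult_1_left mult_zero_right)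
  then show ?thesis by (metis fact_gt_zero)
qed

text \<open>In a linear relation among the \<open>M k\<close>, all terms after the lowest one,
  \<open>M j\<close>, contain the factor \<open>N j\<close>. Solving for \<open>M j\<close> gives
  \<open>M j = Y * (N j * M j)\<close>, and nilpotency of \<open>N j\<close> then forces
  \<open>M j = 0\<close>.\<close>

lemma nilpotent_chain_terminates:
  assumes M: "\<And>k. M k \<in> Q" "\<And>k. M (Suc k) = N k * M k"
    and N: "\<And>i j. N i * N j = N j * N i" "\<And>i. \<exists>n. N i ^ n = 0"
  shows "\<exists>k. M k = 0"
proof -
  obtain q where q: "q \<noteq> 0" and q0: "(\<Sum>i\<le>degree q. scal (coeff q i) * M i) = 0"
    using dependent[of M] M(1) by blast
  define j where "j = (LEAST i. coeff q i \<noteq> 0)"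
  have j: "coeff q j \<noteq> 0" unfolding j_def using q by (metis (mono_tags) LeastI leading_coeff_0_iff)
  have less: "coeff q i = 0" if "i < j" for i using that not_less_Least unfolding j_def by blast
  \<comment> \<open>\<open>Y\<close> is required to commute with \<open>N j\<close> so that powers
    of \<open>Y * N j\<close> can be split later. \<open>T\<close> is closed under addition and
    under multiplication by anything commuting with \<open>N j\<close>.\<close>
  define T where "T = {Y * (N j * M j) |Y. Y * N j = N j * Y}"
  have T_add: "u + v \<in> T" if uv: "u \<in> T" "v \<in> T" for u v
  proof -
    obtain Y Y' where Y: "u = Y * (N j * M j)" "Y * N j = N j * Y"
      "v = Y' * (N j * M j)" "Y' * N j = N j * Y'"
      using uv unfolding T_def by blast
    have "u + v = (Y + Y') * (N j * M j)" "(Y + Y') * N j = N j * (Y + Y')"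
      using Y by (simp_all only: distrib_left distrib_right)
    then show ?thesis unfolding T_def by blast
  qed
  have T_mult: "Z * u \<in> T" if "u \<in> T" "Z * N j = N j * Z" for u Z
  proof -
    obtain Y where Y: "u = Y * (N j * M j)" "Y * N j = N j * Y" using \<open>u \<in> T\<close> unfolding T_def by blast
    have "Z * u = (Z * Y) * (N j * M j)" "(Z * Y) * N j = N j * (Z * Y)"
      using Y that(2) by (simp_all add: mult.assoc) (metis mult.assoc)
    then show ?thesis unfolding T_def by blast
  qed
  have T_0: "0 \<in> T" unfolding T_def by (auto intro!: exI[of _ 0])
  have T_M: "M (Suc (j + i)) \<in> T" for i
  proof (induction i)
    case 0
    show ?case unfolding T_def using M(2)[of j] by (auto intro!: exI[of _ 1])
  next
    case (Suc i)
    then show ?case using T_mult[OF _ N(1)] by (simp add: M(2)[of "Suc (j + i)"])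
  qed
  have T_sum: "(\<Sum>i\<in>I. scal (coeff q i) * M i) \<in> T" if "I \<subseteq> {j<..}" for I
    using that
  proof (induction I rule: infinite_finite_induct)
    case (insert i I)
    have "M i \<in> T" using T_M[of "i - Suc j"] insert.prems by simp
    then have "scal (coeff q i) * M i \<in> T" using T_mult scal_commute by blast
    then show ?case using insert T_add by simp
  qed (simp_all add: T_0)
  have jd: "j \<le> degree q" using j by (rule le_degree)
  have "(\<Sum>i\<le>degree q. scal (coeff q i) * M i) = (\<Sum>i\<in>{j..degree q}. scal (coeff q i) * M i)"
    by (rule sum.mono_neutral_right) (use less in \<open>auto simp: scal_0 not_le\<close>)
  also have "\<dots> = scal (coeff q j) * M j + (\<Sum>i\<in>{j<..degree q}. scal (coeff q i) * M i)"
    by (rule sum.head[OF jd])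
  finally have "scal (coeff q j) * M j = - 1 * (\<Sum>i\<in>{j<..degree q}. scal (coeff q i) * M i)"
    using q0 by (simp add: add_eq_0_iff2)
  also have "\<dots> \<in> T" by (intro T_mult T_sum) auto
  finally have "scal (inverse (coeff q j)) * (scal (coeff q j) * M j) \<in> T"
    by (rule T_mult) (rule scal_commute)
  then have "M j \<in> T" by (simp add: scal_inverse_cancel[OF j])
  then obtain Y where Y: "M j = Y * (N j * M j)" "Y * N j = N j * Y" unfolding T_def by blast
  \<comment> \<open>The equation for \<open>M j\<close> is substituted into itself k times.\<close>
  have "M j = (Y * N j) ^ k * M j" for k
  proof (induction k)
    case (Suc k)
    have "(Y * N j) ^ Suc k * M j = (Y * N j) ^ k * (Y * (N j * M j))"
      by (simp only: power_Suc2 mult.assoc)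
    then show ?case using Suc Y(1) by simp
  qed simp
  moreover obtain n where "N j ^ n = 0" using N(2) by blast
  ultimately have "M j = 0" by (metis power_mult_commuting[OF Y(2)] mult_zero_left mult_zero_right)
  then show ?thesis ..
qed

text \<open>Otherwise factors \<open>N g\<close> could be multiplied on forever without reaching 0,
  against \<open>nilpotent_chain_terminates\<close>. The resulting \<open>M\<close> removes the
  quadratic term that separates the later \<open>N\<close> from an additive map.\<close>

lemma exists_square_annihilated:
  fixes N :: "'i \<Rightarrow> 'r"
  assumes N: "\<And>f g. N f * N g = N g * N f" "\<And>f. \<exists>n. N f ^ n = 0" "\<And>f. N f \<in> Q" and "N f0 \<noteq> 0"
  shows "\<exists>M. (\<exists>f. N f * M \<noteq> 0) \<and> (\<forall>f g. N f * (N g * M) = 0)"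
proof (rule ccontr)
  assume "\<not> ?thesis"
  then have step: "\<exists>f g. N f * (N g * M) \<noteq> 0" if "\<exists>f. N f * M \<noteq> 0" for M using that by blast
  \<comment> \<open>Dependent choice starting at 1. Not being annihilated by all \<open>N f\<close>
    is the invariant under which \<open>step\<close> supplies the next factor.\<close>
  have "\<exists>M. \<forall>k. (M k \<in> Q \<and> (\<exists>f. N f * M k \<noteq> 0)) \<and> (\<exists>g. M (Suc k) = N g * M k)"
  proof (rule dependent_nat_choice)
    show "\<exists>x. x \<in> Q \<and> (\<exists>f. N f * x \<noteq> 0)"
      using Q_1 assms(4) by (intro exI[of _ 1] conjI exI[of _ f0]) simp_all
  next
    fix x and k :: nat assume x: "x \<in> Q \<and> (\<exists>f. N f * x \<noteq> 0)"
    then obtain f g where "N f * (N g * x) \<noteq> 0" using step by blast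
    then show "\<exists>y. (y \<in> Q \<and> (\<exists>f. N f * y \<noteq> 0)) \<and> (\<exists>g. y = N g * x)"
      using x Q_mult[OF N(3)] by blast
  qed
  then obtain M where M: "\<And>k. M k \<in> Q" "\<And>k. \<exists>f. N f * M k \<noteq> 0" "\<And>k. \<exists>g. M (Suc k) = N g * M k"
    by blast
  obtain g where "\<And>k. M (Suc k) = N (g k) * M k" using M(3) by metis
  from nilpotent_chain_terminates[of M "\<lambda>k. N (g k)", OF M(1) this N(1) N(2)]
  show False using M(2) by (metis mult_zero_right)
qed

end

text \<open>The closure rules match what the group provides for \<alpha>: the generator for the
  polynomial 1, products for sums, and conjugation by \<mu> for multiplication by X. Natural
  coefficients keep subtraction out of the induction.\<close>

lemma nat_poly_induct [case_names zero one add mult_X]: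
  fixes P :: "nat poly \<Rightarrow> bool"
  assumes "P 0" "P 1" "\<And>f g. P f \<Longrightarrow> P g \<Longrightarrow> P (f + g)" "\<And>f. P f \<Longrightarrow> P (pCons 0 f)"
  shows "P f"
proof (induction f)
  case (pCons a f)
  have "P [:a:]"
  proof (induction a)
    case (Suc a)
    have "[:Suc a:] = 1 + [:a:]" by (simp add: one_pCons)
    then show ?case using assms Suc by simp
  qed (use assms in simp)
  moreover have "pCons a f = [:a:] + pCons 0 f" by simp
  ultimately show ?case using assms pCons by metis
qed (use assms in simp)

text \<open>An invariant q takes the value q(0) at all natural numbers, which are infinitely many in
  characteristic zero, so q - q(0) has too many roots.\<close>

lemma shift_invariant_poly_const:
  fixes q :: "'f::field poly"
  assumes c: "\<And>n. n > 0 \<Longrightarrow> of_nat n \<noteq> (0::'f)" and q: "pcompose q [:1, 1:] = q"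
  shows "\<exists>a. q = [:a:]"
proof (rule ccontr)
  assume n: "\<not> ?thesis"
  let ?p = "q - [:poly q 0:]"
  have "?p \<noteq> 0" using n by (metis eq_iff_diff_eq_0)
  then have fin: "finite {x. poly ?p x = 0}" by (rule poly_roots_finite)
  have step: "poly q (x + 1) = poly q x" for x
    using arg_cong[OF q, of "\<lambda>p. poly p x"] by (simp add: poly_pcompose add.commute)
  have "poly q (of_nat k) = poly q 0" for k
  proof (induction k)
    case (Suc k) then show ?case using step[of "of_nat k"] by (simp add: add.commute)
  qed simp
  then have "range of_nat \<subseteq> {x. poly ?p x = 0}" by auto
  then have "finite (range (of_nat :: nat \<Rightarrow> 'f))" using fin by (rule finite_subset)
  moreover have "inj (of_nat :: nat \<Rightarrow> 'f)"
  proof (rule linorder_injI)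
    fix i j :: nat assume "i < j"
    then show "of_nat i \<noteq> (of_nat j :: 'f)"
      using c[of "j - i"] by (simp add: of_nat_diff)
  qed
  ultimately show False using finite_imageD infinite_UNIV_nat by blast
qed

text \<open>Substituting X + 1 preserves degree and leading coefficient, so the leading terms
  cancel. Invariant q are excluded because the zero polynomial has degree 0, which is not smaller
  for constants.\<close>

lemma degree_pcompose_shift_less:
  fixes q :: "'f::field poly"
  assumes "pcompose q [:1, 1:] \<noteq> q"
  shows "degree (pcompose q [:1, 1:] - q) < degree q"
proof -
  let ?p = "pcompose q [:1, 1:] - q"
  have d: "degree (pcompose q [:1, 1:]) = degree q" by simp
  have l: "lead_coeff (pcompose q [:1, 1:]) = lead_coeff q" by (subst lead_coeff_comp) simp_all
  have "degree ?p \<le> degree q" using degree_diff_le d by (metis order_refl)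
  moreover have "coeff ?p (degree q) = 0" using l d by simp
  moreover have "?p \<noteq> 0" using assms by simp
  ultimately show ?thesis by (metis le_neq_implies_less leading_coeff_0_iff)
qed

section \<open>Additive maps on polynomials and their annihilators\<close>

context finite_dim_subring
begin

text \<open>For additive \<phi> this is its linear extension to polynomials over the field,
  determined by the values on monomials. Annihilators have to be sought there, since relations have
  field coefficients.\<close>

definition lin_ext :: "(nat poly \<Rightarrow> 'r) \<Rightarrow> 'f poly \<Rightarrow> 'r"
  where "lin_ext \<phi> q = (\<Sum>i\<le>degree q. scal (coeff q i) * \<phi> (monom 1 i))"

lemma lin_ext_0: "lin_ext \<phi> 0 = 0"
  by (simp add: lin_ext_def scal_0)

lemma lin_ext_add: "lin_ext \<phi> (p + q) = lin_ext \<phi> p + lin_ext \<phi> q"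
  unfolding lin_ext_def by (rule sum_coeff_add) (simp add: scal_add distrib_right)

lemma lin_ext_diff: "lin_ext \<phi> (p - q) = lin_ext \<phi> p - lin_ext \<phi> q"
  using lin_ext_add[of \<phi> "p - q" q] by (simp add: algebra_simps)

lemma lin_ext_add_fun: "lin_ext (\<lambda>f. \<phi> f + \<psi> f) q = lin_ext \<phi> q + lin_ext \<psi> q"
  by (simp add: lin_ext_def distrib_left sum.distrib)

lemma lin_ext_pCons:
  "lin_ext \<phi> (pCons a q) = scal a * \<phi> 1 + lin_ext (\<lambda>f. \<phi> (pCons 0 f)) q"
proof -
  have "lin_ext \<phi> (pCons a q)
      = scal a * \<phi> (monom 1 0) + (\<Sum>i\<le>degree q. scal (coeff q i) * \<phi> (monom 1 (Suc i)))"
    unfolding lin_ext_def by (rule sum_coeff_pCons) (simp add: scal_add distrib_right)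
  then show ?thesis by (simp add: lin_ext_def monom_Suc monom_0 one_pCons)
qed

text \<open>Writing the shifted polynomial as a + (1 + X) q(X + 1), the induction hypothesis is
  applied to the additive map sending f to \<phi>(f) + \<phi>(X f); hence \<phi> varies in the
  induction.\<close>

lemma lin_ext_pcompose_shift:
  assumes "\<And>f g. \<phi> (f + g) = \<phi> f + \<phi> g"
  shows "lin_ext \<phi> (pcompose q [:1, 1:]) = lin_ext (\<lambda>f. \<phi> (pcompose f [:1, 1:])) q"
  using assms
proof (induction q arbitrary: \<phi>)
  case (pCons a q)
  let ?S = "\<lambda>f :: nat poly. pcompose f [:1, 1:]"
  have "pcompose (pCons a q) [:1, 1:] = [:a:] + (pcompose q [:1, 1:] + pCons 0 (pcompose q [:1, 1:]))"
    by (simp add: pcompose_pCons)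
  then have "lin_ext \<phi> (pcompose (pCons a q) [:1, 1:])
      = scal a * \<phi> 1 + lin_ext (\<lambda>f. \<phi> f + \<phi> (pCons 0 f)) (pcompose q [:1, 1:])"
    by (simp only: lin_ext_add lin_ext_pCons lin_ext_add_fun lin_ext_0 scal_0) simp
  also have "lin_ext (\<lambda>f. \<phi> f + \<phi> (pCons 0 f)) (pcompose q [:1, 1:])
      = lin_ext (\<lambda>f. \<phi> (?S f) + \<phi> (pCons 0 (?S f))) q"
  proof (rule pCons.IH)
    fix f g :: "nat poly"
    have "pCons 0 (f + g) = pCons 0 f + pCons 0 g" by simp
    then show "\<phi> (f + g) + \<phi> (pCons 0 (f + g)) = \<phi> f + \<phi> (pCons 0 f) + (\<phi> g + \<phi> (pCons 0 g))"
      by (simp only: pCons.prems add_ac)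
  qed
  also have "(\<lambda>f. \<phi> (?S f) + \<phi> (pCons 0 (?S f))) = (\<lambda>f. \<phi> (?S (pCons 0 f)))"
    by (simp add: pcompose_pCons flip: pCons.prems del: One_nat_def)
  finally show ?case by (simp add: lin_ext_pCons pcompose_1)
qed (simp add: lin_ext_0)

text \<open>The claim is proved for all additive linear images of \<open>N\<close> at once: this
  class is stable under the shift and under multiplication by X, and right multiplication by
  \<open>M\<close> yields a member of it.\<close>

lemma additive_linear_image_trivial:
  fixes N :: "nat poly \<Rightarrow> 'r"
  assumes char0: "\<And>n. n > 0 \<Longrightarrow> of_nat n \<noteq> (0::'f)"
    and Q: "\<And>f. N f \<in> Q"
    and S: "\<And>f. N (pcompose f [:1, 1:]) = s * N f * t"
    and X: "\<And>f. N (pCons 0 f) = m * N f * m'"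
    and M: "\<And>f g. N (f + g) * M = N f * M + N g * M"
  shows "N f * M = 0"
proof -
  define E where "E = {\<phi>. (\<forall>f g. \<phi> (f + g) = \<phi> f + \<phi> g) \<and>
    (\<exists>L. (\<forall>u v. L (u + v) = L u + L v) \<and> (\<forall>c u. L (scal c * u) = scal c * L u) \<and> (\<forall>f. \<phi> f = L (N f)))}"
  have E_add: "\<phi> (f + g) = \<phi> f + \<phi> g" if "\<phi> \<in> E" for \<phi> f g using that by (simp add: E_def)
  \<comment> \<open>The new functional is \<open>L\<close> preceded by the map u \<mapsto> a u b,
    which is linear because scalars are central.\<close>
  have E_conj: "(\<lambda>f. \<phi> (c f)) \<in> E"
    if \<phi>: "\<phi> \<in> E" and c: "\<And>f g. c (f + g) = c f + c g" "\<And>f. N (c f) = a * N f * b" for \<phi> c a b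
  proof -
    obtain L where L: "\<And>u v. L (u + v) = L u + L v" "\<And>c u. L (scal c * u) = scal c * L u"
      "\<And>f. \<phi> f = L (N f)" using \<phi> unfolding E_def by blast
    have "a * (scal d * u) * b = scal d * (a * u * b)" for d u
      by (metis mult.assoc scal_commute)
    moreover have "\<phi> (c (f + g)) = \<phi> (c f) + \<phi> (c g)" for f g by (simp only: c(1) E_add[OF \<phi>])
    ultimately show ?thesis unfolding E_def using L c(2)
      by (auto intro!: exI[of _ "\<lambda>u. L (a * u * b)"] simp: distrib_left distrib_right)
  qed
  have E_S: "(\<lambda>f. \<phi> (pcompose f [:1, 1:])) \<in> E" if "\<phi> \<in> E" for \<phi>
    using E_conj[OF that _ S] by (simp add: pcompose_add)
  have E_X: "(\<lambda>f. \<phi> (pCons 0 f)) \<in> E" if "\<phi> \<in> E" for \<phi>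
    using E_conj[OF that _ X] by simp
  define I where "I = {q. q \<noteq> 0 \<and> (\<forall>\<phi>\<in>E. lin_ext \<phi> q = 0)}"
  have "\<exists>q. q \<in> I"
  proof -
    \<comment> \<open>One relation among the \<open>N (monom 1 i)\<close> suffices: each linear
      \<open>L\<close> carries it over to its \<phi>.\<close>
    obtain q where q: "q \<noteq> 0" "(\<Sum>i\<le>degree q. scal (coeff q i) * N (monom 1 i)) = 0"
      using dependent[of "\<lambda>i. N (monom 1 i)"] Q by blast
    have "lin_ext \<phi> q = 0" if \<phi>: "\<phi> \<in> E" for \<phi>
    proof -
      obtain L where L: "\<And>u v. L (u + v) = L u + L v" "\<And>c u. L (scal c * u) = scal c * L u"
        "\<And>f. \<phi> f = L (N f)" using \<phi> unfolding E_def by blast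
      have L0: "L 0 = 0" using L(1)[of 0 0] by simp
      have "L (\<Sum>i\<in>J. g i) = (\<Sum>i\<in>J. L (g i))" for g and J :: "nat set"
        by (induction J rule: infinite_finite_induct) (simp_all add: L L0)
      from this[of "\<lambda>i. scal (coeff q i) * N (monom 1 i)" "{..degree q}"]
      show ?thesis using q(2) by (simp add: lin_ext_def L L0)
    qed
    then show ?thesis using q(1) unfolding I_def by blast
  qed
  then obtain q where q: "q \<in> I" and min: "\<And>p. p \<in> I \<Longrightarrow> degree q \<le> degree p"
    using ex_has_least_nat[of "\<lambda>q. q \<in> I" _ degree] by blast
  \<comment> \<open>Otherwise q(X + 1) - q would be a nonzero annihilator of smaller degree than the
    minimal q.\<close>
  have "pcompose q [:1, 1:] = q"
  proof (rule ccontr)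
    let ?p = "pcompose q [:1, 1:] - q"
    assume ne: "pcompose q [:1, 1:] \<noteq> q"
    have "lin_ext \<phi> ?p = 0" if "\<phi> \<in> E" for \<phi>
      using q that E_S[OF that] by (simp add: lin_ext_diff lin_ext_pcompose_shift[OF E_add] I_def)
    then have "?p \<in> I" using ne by (simp add: I_def)
    then show False using min degree_pcompose_shift_less[OF ne] by (metis not_le)
  qed
  then obtain a where a: "q = [:a:]" using shift_invariant_poly_const[OF char0] by blast
  have one_0: "\<phi> 1 = 0" if "\<phi> \<in> E" for \<phi>
  proof -
    have "a \<noteq> 0" "lin_ext \<phi> [:a:] = 0" using q that by (auto simp: I_def a)
    then show ?thesis using scal_cancel by (simp add: lin_ext_pCons lin_ext_0)
  qed
  \<comment> \<open>Quantifying over \<open>E\<close> inside the induction allows the step from f to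
    X f to use the hypothesis for the composite of \<phi> with multiplication by X.\<close>
  have zero: "\<forall>\<phi>\<in>E. \<phi> f = 0" for f
  proof (induction f rule: nat_poly_induct)
    case zero show ?case
    proof
      fix \<phi> assume "\<phi> \<in> E"
      from E_add[OF this, of 0 0] show "\<phi> 0 = 0" by simp
    qed
  next
    case one show ?case by (intro ballI one_0)
  next
    case (add f g) show ?case
    proof
      fix \<phi> assume "\<phi> \<in> E"
      then show "\<phi> (f + g) = 0" using add.IH[THEN bspec, of \<phi>] by (simp add: E_add)
    qed
  next
    case (mult_X f) show ?case
    proof
      fix \<phi> assume "\<phi> \<in> E"
      from mult_X[THEN bspec, OF E_X[OF this]] show "\<phi> (pCons 0 f) = 0" .
    qed
  qed
  have "(\<lambda>f. N f * M) \<in> E"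
    unfolding E_def by (auto simp: M distrib_right mult.assoc intro!: exI[of _ "\<lambda>u. u * M"])
  from zero[THEN bspec, OF this] show ?thesis .
qed

text \<open>\<open>c\<close> is an exponent for which the \<open>c\<close>-th power of the image of
  1 is unipotent, multiplied in positive characteristic by a torsion exponent of that power.\<close>

theorem affine_action_not_faithful:
  fixes A :: "nat poly \<Rightarrow> 'r"
  assumes Q: "\<And>f. A f \<in> Q"
    and add: "\<And>f g. A (f + g) = A f * A g" and A0: "A 0 = 1" and inv: "\<And>f. \<exists>y. y * A f = 1"
    and s: "s * t = 1" "t * s = 1" and S: "\<And>f. s * A f * t = A (pcompose f [:1, 1:])"
    and m: "m * m' = 1" "m' * m = 1" and X: "\<And>f. m * A f * m' = A (pCons 0 f)"
  shows "\<exists>c>0. A [:c:] = 1"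
proof -
  let ?z = "A [:1:]" and ?x = "A [:0, 1:]"
  have comm: "A f * A g = A g * A f" for f g
    by (metis add add.commute)
  have Apow: "A (Polynomial.smult k f) = A f ^ k" for k f
  proof (induction k)
    case (Suc k)
    have "Polynomial.smult (Suc k) f = f + Polynomial.smult k f" by (simp add: poly_eq_iff)
    then show ?case using Suc by (simp add: add)
  qed (simp add: A0)
  have Az: "A [:k:] = ?z ^ k" for k using Apow[of k "[:1:]"] by simp
  obtain y where y: "y * ?x = 1" using inv by blast
  obtain z' where z': "z' * ?z = 1" using inv by blast
  \<comment> \<open>The substitution of X + 1 turns X into X + 1 and fixes 1, which gives the
    Heisenberg relations between \<open>s\<close>, \<open>?x\<close> and \<open>?z\<close>.\<close>
  have "s * ?x * t = A ([:0, 1:] + [:1:])" by (simp add: S pcompose_pCons)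
  then have "s * ?x * t = ?x * ?z" by (simp only: add)
  moreover have "s * ?z * t = ?z" by (simp add: S)
  then have "s * ?z = ?z * s" by (metis mult.assoc mult_1_right s(2))
  ultimately obtain c n where c: "c > 0" and n: "(?z ^ c - 1) ^ n = 0"
    using heisenberg_quasi_unipotent[OF Q y z' s _ _ comm] by blast
  show ?thesis
  proof (cases "\<forall>n>0. of_nat n \<noteq> (0::'f)")
    case False
    then obtain p where p: "p > 0" "of_nat p = (0::'f)" by blast
    then have "of_nat p = (0::'r)" by (metis scal_0 scal_of_nat)
    then obtain k where "k > 0" "(?z ^ c) ^ k = 1" using unipotent_torsion[OF _ p(1) n] by blast
    then show ?thesis using c by (intro exI[of _ "c * k"]) (simp add: Az[of "c * k"] power_mult)
  next
    case char0: True
    \<comment> \<open>Rescaling by \<open>c\<close> makes the image of 1 unipotent and is compatible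
      with addition and with both conjugations.\<close>
    define B where "B f = A (Polynomial.smult c f)" for f
    define N where "N f = B f - 1" for f
    have B_add: "B (f + g) = B f * B g" for f g by (simp add: B_def smult_add_right add)
    have B_S: "s * B f * t = B (pcompose f [:1, 1:])" for f by (simp add: B_def S pcompose_smult)
    have B_X: "m * B f * m' = B (pCons 0 f)" for f by (simp add: B_def X)
    have N_Q: "N f \<in> Q" for f by (simp add: N_def B_def Q Q_diff Q_1)
    have B_comm: "B f * B g = B g * B f" for f g by (simp add: B_def comm)
    have N_comm: "N f * N g = N g * N f" for f g
      by (simp add: N_def left_diff_distrib right_diff_distrib B_comm)
    have N_S: "N (pcompose f [:1, 1:]) = s * N f * t" for f
      by (simp add: N_def left_diff_distrib right_diff_distrib s flip: B_S del: One_nat_def)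
    have N_X: "N (pCons 0 f) = m * N f * m'" for f
      by (simp add: N_def left_diff_distrib right_diff_distrib m flip: B_X)
    have nil: "\<exists>n. N f ^ n = 0" for f
    proof (induction f rule: nat_poly_induct)
      case zero show ?case by (intro exI[of _ 1]) (simp add: N_def B_def A0)
    next
      case one show ?case using n by (auto simp: N_def B_def Az[of c] one_pCons)
    next
      case (add f g)
      then obtain k l where k: "N f ^ k = 0" and l: "N g ^ l = 0" by blast
      \<comment> \<open>\<open>N (f + g)\<close> equals \<open>N f + B f * N g\<close>, a sum of
        commuting nilpotent elements; the second inherits its exponent from
        \<open>N g\<close>.\<close>
      have "B f * N g = N g * B f" by (simp add: N_def left_diff_distrib right_diff_distrib B_comm)
      then have "(B f * N g) ^ l = 0" using l by (simp add: power_mult_commuting)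
      moreover have "N f * (B f * N g) = B f * N g * N f"
        by (simp add: N_def left_diff_distrib right_diff_distrib mult.assoc B_comm)
      ultimately have "(N f + B f * N g) ^ (k + l) = 0" by (intro nilpotent_add k)
      moreover have "N (f + g) = N f + B f * N g"
        by (simp add: N_def B_add left_diff_distrib right_diff_distrib)
      ultimately show ?case by auto
    next
      case (mult_X f)
      then obtain k where k: "N f ^ k = 0" by blast
      have "(m * u * m') ^ j = m * u ^ j * m'" for u j
      proof (induction j)
        case (Suc j)
        have "(m * u * m') * (m * u ^ j * m') = m * u * (m' * m) * u ^ j * m'" by (simp only: mult.assoc)
        then show ?case using Suc m by (simp add: mult.assoc)
      qed (simp add: m)
      then show ?case using k by (auto simp: N_X intro!: exI[of _ k])
    qed
    have "N f = 0" for f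
    proof (rule ccontr)
      assume "N f \<noteq> 0"
      from exists_square_annihilated[of N, OF N_comm nil N_Q this]
      obtain M g where M: "N g * M \<noteq> 0" "\<And>f g. N f * (N g * M) = 0" by blast
      \<comment> \<open>Multiplication by \<open>M\<close> kills the quadratic term, so
        \<open>N\<close> becomes additive without vanishing at \<open>g\<close>.\<close>
      have "N (f + g) = N f + N g + N f * N g" for f g
        by (simp add: N_def B_add left_diff_distrib right_diff_distrib)
      then have "N (f + g) * M = N f * M + N g * M" for f g
        by (simp add: distrib_right mult.assoc M(2))
      from additive_linear_image_trivial[OF _ N_Q N_S N_X this, of g] char0 M(1)
      show False by blast
    qed
    from this[of 1] show ?thesis using c by (intro exI[of _ c]) (simp add: N_def B_def one_pCons)
  qed
qed

end

section \<open>Matrices as operators on a common space\<close>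

text \<open>The lower bound on the degree drives the induction: it yields two solutions p, q of the
  old conditions with q of larger degree. A combination of them meets the new condition and, having
  the degree of q, is nonzero.\<close>

lemma common_kernel_poly:
  fixes g :: "'k \<Rightarrow> nat \<Rightarrow> 'f::field"
  assumes "finite I"
  shows "\<exists>q. q \<noteq> 0 \<and> degree q \<ge> m \<and> (\<forall>k\<in>I. (\<Sum>i\<le>degree q. coeff q i * g k i) = 0)"
  using assms
proof (induction I arbitrary: m)
  case empty
  show ?case by (intro exI[of _ "monom 1 m"]) (simp add: degree_monom_eq)
next
  case (insert k I)
  define l where "l k q = (\<Sum>i\<le>degree q. coeff q i * g k i)" for k and q :: "'f poly"
  have l_add: "l k (p + q) = l k p + l k q" for k p q
    unfolding l_def by (rule sum_coeff_add) (simp add: distrib_right)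
  have l_smult: "l k (Polynomial.smult a q) = a * l k q" for k a q
    by (cases "a = 0") (simp_all add: l_def sum_distrib_left mult.assoc)
  from insert.IH obtain p where p: "p \<noteq> 0" "m \<le> degree p" "\<forall>k\<in>I. l k p = 0"
    unfolding l_def by blast
  from insert.IH obtain q where q: "q \<noteq> 0" "Suc (degree p) \<le> degree q" "\<forall>k\<in>I. l k q = 0"
    unfolding l_def by blast
  show ?case
  proof (cases "l k p = 0")
    case True
    then show ?thesis using p by (intro exI[of _ p]) (auto simp: l_def)
  next
    case False
    let ?r = "Polynomial.smult (- l k q) p + Polynomial.smult (l k p) q"
    have "degree ?r = degree q"
      using False q(2) by (intro trans[OF degree_add_eq_right]) (auto simp: le_less_trans[OF degree_smult_le])
    moreover have "\<forall>k\<in>insert k I. l k ?r = 0"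
      using p(3) q(3) by (simp only: l_add l_smult) simp
    moreover have "?r \<noteq> 0" using calculation(1) q(2) by force
    ultimately show ?thesis using p(2) q(2)
      by (intro exI[of _ ?r]) (simp add: l_def)
  qed
qed

text \<open>
  A \<open>d \<times> d\<close> matrix acts on the first \<open>d\<close> coordinates of \<open>\<nat> \<Rightarrow> F\<close> and as the identity on the others, so
  that matrices of every size live in one type of class \<^class>\<open>ring_1\<close>.
\<close>

typedef (overloaded) 'f lin_op =
  "{T :: (nat \<Rightarrow> 'f::field) \<Rightarrow> nat \<Rightarrow> 'f.
     \<forall>c u v. T (\<lambda>i. c * u i + v i) = (\<lambda>i. c * T u i + T v i)}"
  by (rule exI[of _ "\<lambda>v. v"]) simp

setup_lifting type_definition_lin_op

instantiation lin_op :: (field) ring_1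
begin

lift_definition zero_lin_op :: "'a lin_op" is "\<lambda>v i. 0" by simp

lift_definition one_lin_op :: "'a lin_op" is "\<lambda>v. v" by simp

lift_definition plus_lin_op :: "'a lin_op \<Rightarrow> 'a lin_op \<Rightarrow> 'a lin_op" is "\<lambda>S T v i. S v i + T v i"
  by (simp add: algebra_simps)

lift_definition minus_lin_op :: "'a lin_op \<Rightarrow> 'a lin_op \<Rightarrow> 'a lin_op" is "\<lambda>S T v i. S v i - T v i"
  by (simp add: algebra_simps)

lift_definition uminus_lin_op :: "'a lin_op \<Rightarrow> 'a lin_op" is "\<lambda>T v i. - T v i"
  by (simp add: algebra_simps)

lift_definition times_lin_op :: "'a lin_op \<Rightarrow> 'a lin_op \<Rightarrow> 'a lin_op" is "\<lambda>S T v. S (T v)"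
  by simp

instance
proof
  fix a b c :: "'a lin_op"
  show "(0::'a lin_op) \<noteq> 1" by transfer (metis zero_neq_one)
  show "a * (b + c) = a * b + a * c"
  proof (transfer, rule ext)
    fix A B C :: "(nat \<Rightarrow> 'a) \<Rightarrow> nat \<Rightarrow> 'a" and v
    assume "\<forall>c u v. A (\<lambda>i. c * u i + v i) = (\<lambda>i. c * A u i + A v i)"
    from this[rule_format, of 1 "B v" "C v"]
    show "A (\<lambda>i. B v i + C v i) = (\<lambda>i. A (B v) i + A (C v) i)" by simp
  qed
qed (transfer, auto simp: algebra_simps)+

end

section \<open>Block operators and their dimension\<close>

lift_definition scal_op :: "'f::field \<Rightarrow> 'f lin_op" is "\<lambda>c v i. c * v i"
  by (simp add: algebra_simps)

text \<open>The scalar \<open>c\<close> on the remaining coordinates, instead of a fixed 1, closes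
  the family under sums, differences and scaling, so that for fixed \<open>d\<close> it is an
  algebra of dimension at most d^2 + 1.\<close>

lift_definition block_op :: "nat \<Rightarrow> (nat \<Rightarrow> nat \<Rightarrow> 'f::field) \<Rightarrow> 'f \<Rightarrow> 'f lin_op"
  is "\<lambda>d a c v i. if i < d then \<Sum>j<d. a i j * v j else c * v i"
  by (auto simp: fun_eq_iff algebra_simps sum.distrib sum_distrib_left)

lemma block_op_cong:
  "(\<And>i j. i < d \<Longrightarrow> j < d \<Longrightarrow> a i j = b i j) \<Longrightarrow> block_op d a c = block_op d b c"
  by transfer (auto simp: fun_eq_iff)

lemma block_op_entry:
  "block_op d a c = block_op d b e \<Longrightarrow> i < d \<Longrightarrow> j < d \<Longrightarrow> a i j = b i j"
proof transfer
  fix d i j :: nat and a b :: "nat \<Rightarrow> nat \<Rightarrow> 'a" and c e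
  assume h: "(\<lambda>v i. if i < d then \<Sum>j<d. a i j * v j else c * v i)
      = (\<lambda>v i. if i < d then \<Sum>j<d. b i j * v j else e * v i)" and "i < d" "j < d"
  from fun_cong[OF fun_cong[OF h, of "\<lambda>k. if k = j then 1 else 0"], of i] \<open>i < d\<close> \<open>j < d\<close>
  show "a i j = b i j" by (simp add: if_distrib[of "(*) _"] cong: if_cong)
qed

lemma block_op_diff: "block_op d a c - block_op d b e = block_op d (\<lambda>i j. a i j - b i j) (c - e)"
  by transfer (auto simp: fun_eq_iff algebra_simps sum_subtractf)

lemma block_op_mult:
  "block_op d a c * block_op d b e = block_op d (\<lambda>i j. \<Sum>k<d. a i k * b k j) (c * e)"
proof (transfer, intro ext)
  fix d i :: nat and a b :: "nat \<Rightarrow> nat \<Rightarrow> 'a" and c e v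
  have "(\<Sum>k<d. a i k * (\<Sum>j<d. b k j * v j)) = (\<Sum>j<d. (\<Sum>k<d. a i k * b k j) * v j)"
    unfolding sum_distrib_left sum_distrib_right by (subst sum.swap) (simp add: mult.assoc)
  then show "(if i < d then \<Sum>j<d. a i j * (if j < d then \<Sum>k<d. b j k * v k else e * v j)
      else c * (if i < d then \<Sum>j<d. b i j * v j else e * v i))
    = (if i < d then \<Sum>j<d. (\<Sum>k<d. a i k * b k j) * v j else c * e * v i)"
    by (simp add: mult.assoc)
qed

lemma block_op_1: "block_op d (\<lambda>i j. if i = j then 1 else 0) 1 = 1"
  by transfer (auto simp: fun_eq_iff if_distrib[of "\<lambda>x. x * _"] cong: if_cong)

lemma block_op_0: "block_op d (\<lambda>i j. 0) 0 = 0"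
  by transfer (auto simp: fun_eq_iff)

lemma block_op_add: "block_op d a c + block_op d b e = block_op d (\<lambda>i j. a i j + b i j) (c + e)"
  by transfer (auto simp: fun_eq_iff algebra_simps sum.distrib)

lemma scal_op_block_op: "scal_op k * block_op d a c = block_op d (\<lambda>i j. k * a i j) (k * c)"
  by transfer (auto simp: fun_eq_iff sum_distrib_left mult.assoc)

lemma finite_dim_subring_lin_op:
  "finite_dim_subring scal_op {block_op d a c |a c. True}" (is "finite_dim_subring _ ?Q")
proof
  show "scal_op (a + b) = scal_op a + scal_op b" for a b :: 'a
    by transfer (simp add: algebra_simps)
  show "scal_op (a * b) = scal_op a * scal_op b" for a b :: 'a
    by transfer (simp add: mult.assoc)
  show "scal_op (1::'a) = 1" by transfer simp
  show "scal_op a * T = T * scal_op a" for a :: 'a and T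
  proof (transfer, rule ext)
    fix a :: 'a and T :: "(nat \<Rightarrow> 'a) \<Rightarrow> nat \<Rightarrow> 'a" and v
    assume h: "\<forall>c u v. T (\<lambda>i. c * u i + v i) = (\<lambda>i. c * T u i + T v i)"
    have "T (\<lambda>i. 0) = (\<lambda>i. 0)"
      using h[rule_format, of "- 1" "\<lambda>i. 0" "\<lambda>i. 0"] by simp
    then show "(\<lambda>i. a * T v i) = T (\<lambda>i. a * v i)" using h[rule_format, of a v "\<lambda>i. 0"] by simp
  qed
  show "1 \<in> ?Q" unfolding block_op_1[of d, symmetric] by blast
  show "x - y \<in> ?Q" "x * y \<in> ?Q" if xy: "x \<in> ?Q" "y \<in> ?Q" for x y :: "'a lin_op"
  proof -
    obtain a c b e where e: "x = block_op d a c" "y = block_op d b e" using xy by blast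
    show "x - y \<in> ?Q" unfolding e block_op_diff by blast
    show "x * y \<in> ?Q" unfolding e block_op_mult by blast
  qed
  show "\<exists>q\<noteq>0. (\<Sum>i\<le>degree q. scal_op (coeff q i) * w i) = 0" if "\<And>i. w i \<in> ?Q" for w :: "nat \<Rightarrow> 'a lin_op"
  proof -
    have "\<forall>i. \<exists>a c. w i = block_op d a c" using that by blast
    then obtain a c where w: "\<And>i. w i = block_op d (a i) (c i)" by metis
    \<comment> \<open>One linear condition for each of the d^2 matrix entries, and one, indexed by
      \<open>None\<close>, for the scalar on the remaining coordinates.\<close>
    define g where "g k n = (case k of None \<Rightarrow> c n | Some (i, j) \<Rightarrow> a n i j)" for k n
    obtain q where q: "q \<noteq> 0"
      "\<And>k. k \<in> insert None (Some ` ({..<d} \<times> {..<d})) \<Longrightarrow> (\<Sum>i\<le>degree q. coeff q i * g k i) = 0"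
      using common_kernel_poly[of "insert None (Some ` ({..<d} \<times> {..<d}))" 0 g] by blast
    have "(\<Sum>n\<in>J. scal_op (coeff q n) * w n)
        = block_op d (\<lambda>i j. \<Sum>n\<in>J. coeff q n * a n i j) (\<Sum>n\<in>J. coeff q n * c n)" for J
      by (induction J rule: infinite_finite_induct)
        (simp_all add: block_op_0 w scal_op_block_op block_op_add)
    moreover have "(\<Sum>n\<le>degree q. coeff q n * c n) = 0" using q(2)[of None] by (simp add: g_def)
    ultimately have "(\<Sum>n\<le>degree q. scal_op (coeff q n) * w n)
        = block_op d (\<lambda>i j. \<Sum>n\<le>degree q. coeff q n * a n i j) 0" by simp
    also have "\<dots> = block_op d (\<lambda>i j. 0) 0"
    proof (rule block_op_cong)
      fix i j assume "i < d" "j < d"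
      then show "(\<Sum>n\<le>degree q. coeff q n * a n i j) = 0"
        using q(2)[of "Some (i, j)"] by (simp add: g_def)
    qed
    finally have "(\<Sum>n\<le>degree q. scal_op (coeff q n) * w n) = block_op d (\<lambda>i j. 0) 0" .
    then show ?thesis using q(1) block_op_0[of d] by (intro exI[of _ q]) simp
  qed
qed

definition mat_op :: "'f::field mat \<Rightarrow> 'f lin_op"
  where "mat_op B = block_op (dim_row B) (\<lambda>i j. B $$ (i, j)) 1"

lemma mat_op_mult:
  assumes "A \<in> carrier_mat d d" "B \<in> carrier_mat d d"
  shows "mat_op (A * B) = mat_op A * mat_op B"
  using assms unfolding mat_op_def
  by (auto simp: block_op_mult scalar_prod_def atLeast0LessThan intro!: block_op_cong)

lemma mat_op_one: "mat_op (1\<^sub>m d) = 1"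
  unfolding mat_op_def block_op_1[of d, symmetric] by (auto intro!: block_op_cong)

lemma mat_op_eq_iff:
  assumes "A \<in> carrier_mat d d" "B \<in> carrier_mat d d"
  shows "mat_op A = mat_op B \<longleftrightarrow> A = B"
proof
  assume "mat_op A = mat_op B"
  then have "block_op d (\<lambda>i j. A $$ (i, j)) 1 = block_op d (\<lambda>i j. B $$ (i, j)) 1"
    using assms by (auto simp: mat_op_def)
  then show "A = B" using assms by (intro eq_matI) (auto dest: block_op_entry)
qed simp

text \<open>A faithful matrix representation, turned into operators by \<open>mat_op\<close>,
  satisfies the hypotheses of \<open>affine_action_not_faithful\<close>; a positive constant acting
  trivially then contradicts injectivity of \<open>a\<close>.\<close>

lemma not_linear_overI:
  fixes G :: "('g, 'm) monoid_scheme" (structure) and a :: "nat poly \<Rightarrow> 'g"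
  assumes G: "group G"
    and a: "\<And>f. a f \<in> carrier G" "\<And>f g. a (f + g) = a f \<otimes> a g" "inj a"
    and s: "s \<in> carrier G" "\<And>f. a f \<otimes> s = s \<otimes> a (pcompose f [:1, 1:])"
    and m: "m \<in> carrier G" "\<And>f. m \<otimes> a f = a (pCons 0 f) \<otimes> m"
  shows "\<not> linear_over TYPE('f::field) G"
proof
  interpret group G by (rule G)
  assume "linear_over TYPE('f) G"
  then obtain d and h :: "'g \<Rightarrow> 'f mat"
    where h: "h \<in> hom G (GL TYPE('f) d)" and inj: "inj_on h (carrier G)"
    unfolding linear_over_def by blast
  have GL: "group (GL TYPE('f) d)"
    unfolding GL_def by (rule monoid.units_group[OF ring.is_monoid[OF ring_mat]])
  have car: "h x \<in> carrier_mat d d" if "x \<in> carrier G" for x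
    using hom_in_carrier[OF h that] by (auto simp: GL_def units_of_def Units_def ring_mat_def)
  define H where "H x = mat_op (h x)" for x
  have mult: "H (x \<otimes> y) = H x * H y" if "x \<in> carrier G" "y \<in> carrier G" for x y
    using hom_mult[OF h that] mat_op_mult[OF car car, OF that]
    by (simp add: H_def GL_def units_of_def ring_mat_def)
  have one: "H \<one> = 1"
    using hom_one[OF h G GL] by (simp add: H_def GL_def units_of_def ring_mat_def mat_op_one)
  have H_inj: "x = y" if "H x = H y" "x \<in> carrier G" "y \<in> carrier G" for x y
    using that inj mat_op_eq_iff[OF car car, OF that(2,3)] by (auto simp: H_def dest: inj_onD)
  have inv_l: "H (inv x) * H x = 1" and inv_r: "H x * H (inv x) = 1" if "x \<in> carrier G" for x
    using that by (simp_all flip: mult add: one)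
  have "a 0 \<otimes> a 0 = a 0" using a(2)[of 0 0] by simp
  then have a0: "H (a 0) = 1" using a(1) l_cancel_one one by metis
  interpret finite_dim_subring scal_op "{block_op d b c |b c. True} :: 'f lin_op set"
    by (rule finite_dim_subring_lin_op)
  have "\<exists>c>0. H (a [:c:]) = 1"
  proof (rule affine_action_not_faithful)
    show "H (a f) \<in> {block_op d b c |b c. True}" for f
      unfolding H_def mat_op_def carrier_matD(1)[OF car[OF a(1)]] by blast
    show "H (a (f + g)) = H (a f) * H (a g)" for f g by (simp add: a mult)
    show "H (a 0) = 1" by (rule a0)
    show "\<exists>y. y * H (a f) = 1" for f using inv_l a(1) by blast
    \<comment> \<open>In the order of the relation for \<open>s\<close>, it is \<open>inv s\<close>
      that conjugates \<open>a f\<close> to its shift, so \<open>H (inv s)\<close> takes the place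
      of the ring element called s there.\<close>
    show "H (inv s) * H s = 1" "H s * H (inv s) = 1" "H m * H (inv m) = 1" "H (inv m) * H m = 1"
      using inv_l inv_r s(1) m(1) by blast+
    show "H (inv s) * H (a f) * H s = H (a (pcompose f [:1, 1:]))" for f
      using s a(1) by (simp flip: mult add: m_assoc) (simp flip: m_assoc)
    show "H m * H (a f) * H (inv m) = H (a (pCons 0 f))" for f
      using m a(1) by (simp flip: mult) (simp add: m_assoc)
  qed
  then obtain c where c: "c > 0" "H (a [:c:]) = 1" by blast
  then have "a [:c:] = a 0" using a0 H_inj a(1) by metis
  then show False using a(3) c(1) by (auto dest: injD)
qed

section \<open>Relations in the Cremona group\<close>

lemma field_hom_eq_on_base:
  assumes "field_hom \<phi>" "field_hom \<psi>"
    and c: "\<And>c. \<phi> (const2 c) = \<psi> (const2 c)" and 1: "\<phi> t1 = \<psi> t1"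
  shows "\<phi> (to_fract [:r :: 'a::field ratfun:]) = (\<psi> (to_fract [:r:]) :: 'b::field)"
proof -
  interpret f: field_hom \<phi> by fact
  interpret g: field_hom \<psi> by fact
  have p: "\<phi> (to_fract [:to_fract p:]) = \<psi> (to_fract [:to_fract p:])" for p :: "'a poly"
  proof (induction p)
    case (pCons a p)
    have "to_fract [:to_fract (pCons a p):] = const2 a + t1 * to_fract [:to_fract p:]"
      by (simp add: const2_def t1_def to_fract_def)
    then show ?case using pCons c 1 by (simp add: f.hom_add f.hom_mult g.hom_add g.hom_mult)
  qed simp
  obtain p q where "r = Fract p q" "q \<noteq> 0" by (cases r)
  then have "to_fract [:r:] = to_fract [:to_fract p:] / to_fract [:to_fract q:]"
    by (simp add: to_fract_divide to_fract_const_divide)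
  then show ?thesis using p by (simp add: f.hom_div g.hom_div)
qed

text \<open>The constants, t1 and t2 generate the function field, so every relation in the Cremona
  group can be checked on \<open>t1\<close> and \<open>t2\<close>.\<close>

lemma Cr2_eqI:
  assumes "\<phi> \<in> carrier Cr2" "\<psi> \<in> carrier Cr2" and 1: "\<phi> t1 = \<psi> t1" and 2: "\<phi> t2 = \<psi> t2"
  shows "\<phi> = (\<psi> :: 'a::field ratfun2 \<Rightarrow> _)"
proof
  fix r :: "'a ratfun2"
  interpret f: field_hom \<phi> using assms by (simp add: Cr2_def)
  interpret g: field_hom \<psi> using assms by (simp add: Cr2_def)
  have b: "\<phi> (to_fract [:r:]) = \<psi> (to_fract [:r:])" for r
    by (rule field_hom_eq_on_base[OF f.field_hom_axioms g.field_hom_axioms _ 1])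
      (use assms in \<open>simp add: Cr2_def\<close>)
  have p: "\<phi> (to_fract p) = \<psi> (to_fract p)" for p :: "'a ratfun poly"
  proof (induction p)
    case (pCons a p)
    have "to_fract (pCons a p) = to_fract [:a:] + t2 * to_fract p"
      by (simp add: t2_def to_fract_def)
    then show ?case using pCons b 2 by (simp add: f.hom_add f.hom_mult g.hom_add g.hom_mult)
  qed simp
  obtain p q where "r = Fract p q" "q \<noteq> 0" by (cases r)
  then show "\<phi> r = \<psi> r" using p by (simp add: to_fract_divide f.hom_div g.hom_div)
qed

text \<open>The functions of x alone: K(t1) as the field of constants of K(t1)(t2).\<close>

abbreviation base :: "'a::field ratfun \<Rightarrow> 'a ratfun2"
  where "base r \<equiv> to_fract [:r:]"

text \<open>\<open>alpha\<close>, \<open>mu\<close> and \<open>shift\<close> are all special cases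
  of the map (x,y) \<mapsto> (x + t, f(x) + g(x) y), so a single computation serves the
  three.\<close>

lemma birat_values:
  fixes t :: "'a::field" and f g :: "'a ratfun"
  assumes g: "g \<noteq> 0"
  defines "\<phi> \<equiv> birat (t1 + const2 t) (to_fract [:f, g:])"
  shows "\<phi> (base r) = eval1 (t1 + const2 t) r"
    and "\<phi> (base (to_fract p)) = base (to_fract (pcompose p [:t, 1:]))"
    and "\<phi> t1 = t1 + const2 t" and "\<phi> t2 = base f + t2 * base g"
proof -
  let ?a = "t1 + const2 t" and ?b = "to_fract [:f, g:]"
  interpret e1: embedding "\<lambda>p. eval_poly const2 p ?a" by (rule embedding1)
  interpret s: field_hom "eval1 ?a"
    unfolding eval1_def by (rule e1.field_hom_fract_lift)
  interpret e2: embedding "\<lambda>p. eval_poly (eval1 ?a) p ?b" by (rule embedding2[OF g])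
  show c: "\<phi> (base r) = eval1 ?a r" for r
    by (simp add: \<phi>_def birat_def e2.fract_lift_to_fract eval_poly_pCons_hom)
  show e: "\<phi> (base (to_fract p)) = base (to_fract (pcompose p [:t, 1:]))" for p
    unfolding c unfolding eval1_def e1.fract_lift_to_fract by (rule eval_poly_const2_shift)
  show "\<phi> t1 = ?a"
    using e[of "[:0, 1:]"]
    by (simp add: pcompose_pCons flip: t1_def) (simp add: t1_def const2_def to_fract_def)
  show "\<phi> t2 = base f + t2 * base g"
    by (simp add: t2_def \<phi>_def birat_def e2.fract_lift_to_fract eval_poly_pCons_hom)
      (simp add: to_fract_def)
qed


section \<open>Relations between \<open>alpha\<close>, \<open>mu\<close> and
  \<open>shift\<close>\<close>

lemma Cr2_mult: "\<phi> \<otimes>\<^bsub>Cr2\<^esub> \<psi> = \<psi> \<circ> \<phi>"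
  by (simp add: Cr2_def)

lemma Cr2_field_hom: "\<phi> \<in> carrier Cr2 \<Longrightarrow> field_hom \<phi>"
  by (simp add: Cr2_def)

lemma const2_0: "const2 0 = 0"
  by (simp add: const2_def)

lemma base_add: "base (f + g) = base f + base g"
  by (simp flip: to_fract_add)

lemma base_mult: "base (f * g) = base f * base g"
  by (simp flip: to_fract_mult)

lemma base_1: "base 1 = 1"
  by (simp add: to_fract_def One_fract_def one_pCons)

lemma base_eq_iff: "base f = base g \<longleftrightarrow> f = g"
  by (simp add: to_fract_def eq_fract)

lemma alpha_values: "alpha f t1 = t1" "alpha f t2 = t2 + base f" "alpha f (base r) = base r"
  using birat_values[of 1 0 f]
  by (simp_all add: alpha_def eval1_t1 t2_def const2_0 base_1 add.commute flip: to_fract_add)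

lemma mu_values:
  assumes "g \<noteq> 0"
  shows "mu g t1 = t1" "mu g t2 = t2 * base g" "mu g (base r) = base r"
  using birat_values[of g 0 0] assms
  by (simp_all add: mu_def eval1_t1 t2_def const2_0 flip: to_fract_mult)

lemma shift_values:
  "shift t t1 = t1 + const2 t" "shift t t2 = t2"
  "shift t (base (to_fract p)) = base (to_fract (pcompose p [:t, 1:]))"
  using birat_values[of 1 t 0]
  by (simp_all add: shift_def t2_def base_1)

lemma alpha_add: "alpha (f + g) = alpha f \<otimes>\<^bsub>Cr2\<^esub> alpha g"
proof (rule Cr2_eqI)
  interpret h: field_hom "alpha g" by (rule Cr2_field_hom[OF alpha_mem_Cr2])
  show "alpha (f + g) t2 = (alpha f \<otimes>\<^bsub>Cr2\<^esub> alpha g) t2"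
    by (simp add: Cr2_mult alpha_values h.hom_add base_add add_ac del: add_pCons)
  show "alpha (f + g) t1 = (alpha f \<otimes>\<^bsub>Cr2\<^esub> alpha g) t1"
    by (simp add: Cr2_mult alpha_values)
qed (simp_all add: alpha_mem_Cr2 group.is_monoid[OF group_Cr2] monoid.m_closed)

text \<open>Both sides are the transformation (x,y) \<mapsto> (x, (y + f(x)) g(x)).\<close>

lemma mu_alpha:
  assumes "g \<noteq> 0" shows "mu g \<otimes>\<^bsub>Cr2\<^esub> alpha f = alpha (f * g) \<otimes>\<^bsub>Cr2\<^esub> mu g"
proof (rule Cr2_eqI)
  interpret h: field_hom "alpha f" by (rule Cr2_field_hom[OF alpha_mem_Cr2])
  interpret k: field_hom "mu g" by (rule Cr2_field_hom[OF mu_mem_Cr2[OF assms]])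
  show "(mu g \<otimes>\<^bsub>Cr2\<^esub> alpha f) t2 = (alpha (f * g) \<otimes>\<^bsub>Cr2\<^esub> mu g) t2"
    by (simp add: Cr2_mult alpha_values mu_values[OF assms] h.hom_mult k.hom_add k.hom_mult base_mult distrib_right
        del: mult_pCons_left)
  show "(mu g \<otimes>\<^bsub>Cr2\<^esub> alpha f) t1 = (alpha (f * g) \<otimes>\<^bsub>Cr2\<^esub> mu g) t1"
    by (simp add: Cr2_mult alpha_values mu_values[OF assms])
qed (simp_all add: alpha_mem_Cr2 mu_mem_Cr2[OF assms] group.is_monoid[OF group_Cr2] monoid.m_closed)

text \<open>Both sides are (x,y) \<mapsto> (x + t, y + p(x + t)); for polynomials the substitution
  of X + t is available as \<open>pcompose\<close>.\<close>

lemma alpha_shift: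
  "alpha (to_fract p) \<otimes>\<^bsub>Cr2\<^esub> shift t = shift t \<otimes>\<^bsub>Cr2\<^esub> alpha (to_fract (pcompose p [:t, 1:]))"
proof (rule Cr2_eqI)
  interpret h: field_hom "shift t" by (rule Cr2_field_hom[OF shift_mem_Cr2])
  interpret k: field_hom "alpha f" for f by (rule Cr2_field_hom[OF alpha_mem_Cr2])
  have c: "alpha f (const2 t) = const2 t" for f using alpha_mem_Cr2[of f] by (simp add: Cr2_def)
  show "(alpha (to_fract p) \<otimes>\<^bsub>Cr2\<^esub> shift t) t2
      = (shift t \<otimes>\<^bsub>Cr2\<^esub> alpha (to_fract (pcompose p [:t, 1:]))) t2"
    by (simp add: Cr2_mult alpha_values shift_values h.hom_add)
  show "(alpha (to_fract p) \<otimes>\<^bsub>Cr2\<^esub> shift t) t1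
      = (shift t \<otimes>\<^bsub>Cr2\<^esub> alpha (to_fract (pcompose p [:t, 1:]))) t1"
    by (simp add: Cr2_mult alpha_values shift_values k.hom_add c)
qed (simp_all add: alpha_mem_Cr2 shift_mem_Cr2 group.is_monoid[OF group_Cr2] monoid.m_closed)

lemma mu_shift:
  assumes "p \<noteq> 0"
  shows "mu (to_fract p) \<otimes>\<^bsub>Cr2\<^esub> shift t = shift t \<otimes>\<^bsub>Cr2\<^esub> mu (to_fract (pcompose p [:t, 1:]))"
proof (rule Cr2_eqI)
  have n: "to_fract p \<noteq> 0" "to_fract (pcompose p [:t, 1:]) \<noteq> 0"
    using assms by (simp_all add: pcompose_eq_0_iff)
  interpret h: field_hom "shift t" by (rule Cr2_field_hom[OF shift_mem_Cr2])
  interpret k: field_hom "mu (to_fract (pcompose p [:t, 1:]))" by (rule Cr2_field_hom[OF mu_mem_Cr2[OF n(2)]])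
  have c: "mu (to_fract (pcompose p [:t, 1:])) (const2 t) = const2 t"
    using mu_mem_Cr2[OF n(2)] by (simp add: Cr2_def)
  show "(mu (to_fract p) \<otimes>\<^bsub>Cr2\<^esub> shift t) t2
      = (shift t \<otimes>\<^bsub>Cr2\<^esub> mu (to_fract (pcompose p [:t, 1:]))) t2"
    by (simp add: Cr2_mult mu_values[OF n(1)] mu_values[OF n(2)] shift_values h.hom_mult)
  show "(mu (to_fract p) \<otimes>\<^bsub>Cr2\<^esub> shift t) t1
      = (shift t \<otimes>\<^bsub>Cr2\<^esub> mu (to_fract (pcompose p [:t, 1:]))) t1"
    by (simp add: Cr2_mult mu_values[OF n(1)] mu_values[OF n(2)] shift_values k.hom_add c)
  show "mu (to_fract p) \<otimes>\<^bsub>Cr2\<^esub> shift t \<in> carrier Cr2"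
    "shift t \<otimes>\<^bsub>Cr2\<^esub> mu (to_fract (pcompose p [:t, 1:])) \<in> carrier Cr2"
    by (intro monoid.m_closed group.is_monoid group_Cr2 mu_mem_Cr2 shift_mem_Cr2 n)+
qed


text \<open>The family that plays the role of \<open>a\<close> in
  \<open>not_linear_overI\<close>.\<close>

definition poly_translation :: "nat poly \<Rightarrow> rat ratfun2 \<Rightarrow> rat ratfun2"
  where "poly_translation f = alpha (to_fract (map_poly of_nat f))"

lemma map_poly_of_nat_add:
  "map_poly of_nat (f + g) = map_poly of_nat f + (map_poly of_nat g :: rat poly)"
  by (simp add: poly_eq_iff coeff_map_poly)

lemma map_poly_of_nat_X: "map_poly of_nat (pCons 0 f) = map_poly of_nat f * [:0, 1 :: rat:]"
  by (simp add: Polynomial.map_poly_pCons)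

lemma map_poly_of_nat_shift:
  "map_poly of_nat (pcompose f [:1, 1:]) = pcompose (map_poly of_nat f) [:1, 1 :: rat:]"
proof -
  have "comm_semiring_hom (of_nat :: nat \<Rightarrow> rat)" by unfold_locales simp_all
  from comm_semiring_hom.map_poly_pcompose[OF this, of f "[:1, 1:]"]
  show ?thesis by (simp add: Polynomial.map_poly_pCons)
qed

lemma inj_poly_translation: "inj poly_translation"
proof (rule injI)
  fix f g assume "poly_translation f = poly_translation g"
  then have "alpha (to_fract (map_poly of_nat f)) t2 = alpha (to_fract (map_poly of_nat g)) (t2 :: rat ratfun2)"
    by (simp add: poly_translation_def)
  then have "map_poly of_nat f = (map_poly of_nat g :: rat poly)"
    by (simp add: alpha_values base_eq_iff)
  then show "f = g" by (simp add: poly_eq_iff coeff_map_poly)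
qed

section \<open>The group generated by the three transformations\<close>

abbreviation crem_gens :: "(rat ratfun2 \<Rightarrow> rat ratfun2) set"
  where "crem_gens \<equiv> {shift 1, alpha 1, mu (to_fract [:0, 1:])}"

abbreviation crem_group :: "(rat ratfun2 \<Rightarrow> rat ratfun2) monoid"
  where "crem_group \<equiv> subgroup_generated Cr2 crem_gens"

lemma crem_gens_subset: "crem_gens \<subseteq> carrier Cr2"
  by (simp add: shift_mem_Cr2 alpha_mem_Cr2 mu_mem_Cr2)

interpretation Cr2: group "Cr2 :: (rat ratfun2 \<Rightarrow> rat ratfun2) monoid"
  by (rule group_Cr2)

interpretation crem: group crem_group
  by (rule Cr2.group_subgroup_generated)

lemma crem_gens_crem: "crem_gens \<subseteq> carrier crem_group"
  using Cr2.subgroup_generated_subset_carrier_subset[OF crem_gens_subset] .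

lemma X_nonzero: "to_fract [:0, 1 :: rat:] \<noteq> 0" by simp

lemma poly_translation_add:
  "poly_translation (f + g) = poly_translation f \<otimes>\<^bsub>crem_group\<^esub> poly_translation g"
  by (simp add: poly_translation_def map_poly_of_nat_add alpha_add)

lemma poly_translation_shift:
  "poly_translation f \<otimes>\<^bsub>crem_group\<^esub> shift 1 = shift 1 \<otimes>\<^bsub>crem_group\<^esub> poly_translation (pcompose f [:1, 1:])"
  by (simp add: poly_translation_def map_poly_of_nat_shift alpha_shift del: One_nat_def)

lemma poly_translation_mu:
  "mu (to_fract [:0, 1:]) \<otimes>\<^bsub>crem_group\<^esub> poly_translation f
    = poly_translation (pCons 0 f) \<otimes>\<^bsub>crem_group\<^esub> mu (to_fract [:0, 1:])"
  using mu_alpha[OF X_nonzero, of "to_fract (map_poly of_nat f)"]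
  by (simp add: poly_translation_def map_poly_of_nat_X del: mult_pCons_right)

text \<open>\<alpha> at 1 is a generator, sums of polynomials become products, and multiplication by
  X is conjugation by the generator \<mu>.\<close>

lemma poly_translation_mem: "poly_translation f \<in> carrier crem_group"
proof (induction f rule: nat_poly_induct)
  case zero
  have "poly_translation 0 = \<one>\<^bsub>Cr2\<^esub>"
    by (rule Cr2_eqI[OF _ Cr2.one_closed])
      (simp_all add: poly_translation_def alpha_values alpha_mem_Cr2, simp_all add: Cr2_def)
  then show ?case using crem.one_closed by simp
next
  case one
  then show ?case using crem_gens_crem by (simp add: poly_translation_def)
next
  case (add f g) then show ?case unfolding poly_translation_add by (rule crem.m_closed)
next
  case (mult_X f)
  let ?m = "mu (to_fract [:0, 1:]) :: rat ratfun2 \<Rightarrow> rat ratfun2"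
  have m: "?m \<in> carrier crem_group" using crem_gens_crem by simp
  have p: "poly_translation (pCons 0 f) \<in> carrier Cr2" by (simp add: poly_translation_def alpha_mem_Cr2)
  have mC: "?m \<in> carrier Cr2" using crem_gens_subset by simp
  have "poly_translation (pCons 0 f) = (?m \<otimes>\<^bsub>Cr2\<^esub> poly_translation f) \<otimes>\<^bsub>Cr2\<^esub> inv\<^bsub>Cr2\<^esub> ?m"
    using poly_translation_mu[of f] p mC by (simp add: Cr2.m_assoc)
  also have "inv\<^bsub>Cr2\<^esub> ?m = inv\<^bsub>crem_group\<^esub> ?m" using Cr2.inv_subgroup_generated[OF m] by simp
  also have "(?m \<otimes>\<^bsub>Cr2\<^esub> poly_translation f) \<otimes>\<^bsub>Cr2\<^esub> inv\<^bsub>crem_group\<^esub> ?m \<in> carrier crem_group"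
    using crem.m_closed[OF crem.m_closed[OF m mult_X] crem.inv_closed[OF m]] by simp
  finally show ?case .
qed

lemma crem_not_linear: "\<not> linear_over TYPE('f::field) crem_group"
  by (rule not_linear_overI[OF crem.group_axioms poly_translation_mem poly_translation_add
        inj_poly_translation _ poly_translation_shift _ poly_translation_mu])
    (use crem_gens_crem in auto)

lemma crem_finitely_generated: "finitely_generated crem_group"
  unfolding finitely_generated_def
proof (intro exI[of _ crem_gens] conjI crem_gens_crem)
  show "finite crem_gens" by simp
  have "generate crem_group crem_gens = carrier (subgroup_generated crem_group crem_gens)"
    using crem_gens_crem by (simp only: carrier_subgroup_generated[of crem_group] inf.absorb2)
  then show "generate crem_group crem_gens = carrier crem_group"
    by (simp only: Cr2.subgroup_generated2)
qed

section \<open>Derived series\<close>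

lemma const2_add: "const2 (a + b) = const2 a + const2 b"
  by (simp add: const2_def flip: to_fract_add)

text \<open>Both sides are polynomials of degree at most one in t2, which is transcendental over
  K(t1).\<close>

lemma affine_coeffs_unique:
  "t2 * base g + base f = t2 * base g' + base f' \<longleftrightarrow> g = g' \<and> f = f'"
proof -
  have "t2 * base g + base f = to_fract [:f, g:]" for f g :: "'a ratfun"
    by (simp add: t2_def flip: to_fract_add to_fract_mult)
  then show ?thesis by (auto simp: to_fract_def eq_fract)
qed

lemma base_uminus: "base (- f) = - base f"
  using base_add[of "- f" f] by (simp add: add_eq_0_iff2)

lemma mu_mult:
  assumes "g \<noteq> 0" "h \<noteq> 0" shows "mu (g * h) = mu g \<otimes>\<^bsub>Cr2\<^esub> mu h"
proof (rule Cr2_eqI)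
  have gh: "g * h \<noteq> 0" using assms by simp
  interpret h: field_hom "mu h" by (rule Cr2_field_hom[OF mu_mem_Cr2[OF assms(2)]])
  show "mu (g * h) t2 = (mu g \<otimes>\<^bsub>Cr2\<^esub> mu h) t2"
    unfolding Cr2_mult comp_apply mu_values[OF gh] mu_values[OF assms(1)] mu_values[OF assms(2)]
      h.hom_mult base_mult by (simp only: mult_ac)
  show "mu (g * h) t1 = (mu g \<otimes>\<^bsub>Cr2\<^esub> mu h) t1"
    by (simp add: Cr2_mult mu_values[OF gh] mu_values[OF assms(1)] mu_values[OF assms(2)])
  show "mu (g * h) \<in> carrier Cr2" by (rule mu_mem_Cr2[OF gh])
  show "mu g \<otimes>\<^bsub>Cr2\<^esub> mu h \<in> carrier Cr2"
    by (intro monoid.m_closed group.is_monoid group_Cr2 mu_mem_Cr2 assms)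
qed

text \<open>On functions of x alone \<phi> agrees with \<open>shift k\<close>, since both fix the
  constants and have the same value at t1.\<close>

lemma translation_maps_base:
  fixes k :: "'a::field"
  assumes \<phi>: "\<phi> \<in> carrier Cr2" "\<phi> t1 = t1 + const2 k"
  shows "\<exists>r'. \<phi> (base r) = base r'"
proof -
  have "\<phi> (base r) = shift k (base r)"
    by (rule field_hom_eq_on_base[OF Cr2_field_hom[OF \<phi>(1)] Cr2_field_hom[OF shift_mem_Cr2]])
      (use \<phi> shift_mem_Cr2[of k] in \<open>auto simp: shift_values Cr2_def\<close>)
  also have "\<dots> = eval1 (t1 + const2 k) r"
    using birat_values(1)[of 1 k 0 r] by (simp add: shift_def t2_def)
  finally show ?thesis using eval1_base by metis
qed

text \<open>Comparison with \<open>alpha 0\<close>, which is the identity on functions of x.\<close>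

lemma fixes_t1_fixes_base:
  fixes r :: "'a::field ratfun"
  assumes \<phi>: "\<phi> \<in> carrier Cr2" "\<phi> t1 = t1"
  shows "\<phi> (base r) = base r"
proof -
  have "\<phi> (base r) = alpha 0 (base r)"
    by (rule field_hom_eq_on_base[OF Cr2_field_hom[OF \<phi>(1)] Cr2_field_hom[OF alpha_mem_Cr2]])
      (use \<phi> alpha_mem_Cr2[of "0 :: 'a ratfun"] in \<open>auto simp: alpha_values Cr2_def\<close>)
  then show ?thesis by (simp add: alpha_values)
qed

text \<open>The maps (x,y) \<mapsto> (x + k, g(x) y + f(x)). This group contains the three
  generators; \<open>fibrewise_affine\<close> and \<open>fibrewise_translations\<close> below bound
  the first and the second derived subgroup.\<close>

definition translation_triangular :: "('a::field ratfun2 \<Rightarrow> 'a ratfun2) set"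
  where "translation_triangular = {\<phi> \<in> carrier Cr2. (\<exists>k. \<phi> t1 = t1 + const2 k) \<and>
    (\<exists>f g. g \<noteq> 0 \<and> \<phi> t2 = t2 * base g + base f)}"

definition fibrewise_affine :: "('a::field ratfun2 \<Rightarrow> 'a ratfun2) set"
  where "fibrewise_affine = {\<phi> \<in> carrier Cr2. \<phi> t1 = t1 \<and>
    (\<exists>f g. g \<noteq> 0 \<and> \<phi> t2 = t2 * base g + base f)}"

definition fibrewise_translations :: "('a::field ratfun2 \<Rightarrow> 'a ratfun2) set"
  where "fibrewise_translations = {\<phi> \<in> carrier Cr2. \<phi> t1 = t1 \<and> (\<exists>f. \<phi> t2 = t2 + base f)}"

lemma translation_triangularI:
  "\<phi> \<in> carrier Cr2 \<Longrightarrow> \<phi> t1 = t1 + const2 k \<Longrightarrow> g \<noteq> 0 \<Longrightarrow> \<phi> t2 = t2 * base g + base f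
    \<Longrightarrow> \<phi> \<in> translation_triangular"
  unfolding translation_triangular_def by blast

lemma Cr2_inv_apply:
  assumes "\<phi> \<in> carrier (Cr2 :: ('a::field ratfun2 \<Rightarrow> 'a ratfun2) monoid)"
  shows "(inv\<^bsub>Cr2\<^esub> \<phi>) (\<phi> x) = x"
proof -
  interpret group "Cr2 :: ('a ratfun2 \<Rightarrow> 'a ratfun2) monoid" by (rule group_Cr2)
  have "\<phi> \<otimes>\<^bsub>Cr2\<^esub> inv\<^bsub>Cr2\<^esub> \<phi> = \<one>\<^bsub>Cr2\<^esub>" using assms by (rule r_inv)
  then show ?thesis by (simp add: Cr2_def fun_eq_iff)
qed

lemma subgroup_translation_triangular:
  "subgroup translation_triangular (Cr2 :: ('a::field ratfun2 \<Rightarrow> 'a ratfun2) monoid)"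
proof -
  interpret group "Cr2 :: ('a ratfun2 \<Rightarrow> 'a ratfun2) monoid" by (rule group_Cr2)
  show ?thesis
  proof (rule subgroupI)
    show "translation_triangular \<subseteq> carrier (Cr2 :: ('a ratfun2 \<Rightarrow> 'a ratfun2) monoid)"
      by (auto simp: translation_triangular_def)
    have "alpha 0 \<in> (translation_triangular :: ('a ratfun2 \<Rightarrow> 'a ratfun2) set)"
      unfolding translation_triangular_def
    proof (intro CollectI conjI exI alpha_mem_Cr2)
      show "alpha 0 t1 = t1 + const2 0" by (simp add: alpha_values const2_0)
      show "alpha 0 t2 = t2 * base 1 + base 0" by (simp add: alpha_values base_1)
    qed simp
    then show "(translation_triangular :: ('a ratfun2 \<Rightarrow> 'a ratfun2) set) \<noteq> {}" by blast
  next
    fix \<phi> :: "'a ratfun2 \<Rightarrow> 'a ratfun2" assume "\<phi> \<in> translation_triangular"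
    then obtain k f g where \<phi>: "\<phi> \<in> carrier Cr2" "\<phi> t1 = t1 + const2 k"
      "g \<noteq> 0" "\<phi> t2 = t2 * base g + base f" unfolding translation_triangular_def by blast
    define \<psi> where "\<psi> = inv\<^bsub>Cr2\<^esub> \<phi>"
    have \<psi>: "\<psi> \<in> carrier Cr2" using \<phi>(1) by (simp add: \<psi>_def)
    interpret h: field_hom \<psi> by (rule Cr2_field_hom[OF \<psi>])
    note cancel = Cr2_inv_apply[OF \<phi>(1), folded \<psi>_def]
    have "\<psi> (const2 k) = const2 k" using \<psi> by (simp add: Cr2_def)
    then have "t1 = \<psi> t1 + const2 k" using cancel[of t1] by (simp add: \<phi>(2) h.hom_add)
    then have t1: "\<psi> t1 = t1 + const2 (- k)" using const2_add[of k "- k"]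
      by (simp add: const2_0) (metis add.assoc add.right_neutral)
    \<comment> \<open>Since \<psi> preserves K(t1), its value at t2 satisfies a linear equation over
      K(t1), which is solved below.\<close>
    obtain f' g' where f': "\<psi> (base f) = base f'" and g': "\<psi> (base g) = base g'"
      using translation_maps_base[OF \<psi> t1] by metis
    have g'0: "g' \<noteq> 0"
      using injD[OF field_hom_inj[OF h.field_hom_axioms], of "base g" 0] g' \<phi>(3) by auto
    have "\<psi> t2 * base g' + base f' = t2"
      using cancel[of t2] by (simp add: \<phi>(4) h.hom_add h.hom_mult f' g')
    then have "t2 - base f' = \<psi> t2 * base g'" by (metis add_diff_cancel_right')
    then have "(t2 - base f') * base (inverse g') = \<psi> t2 * (base g' * base (inverse g'))"
      by (simp only: mult.assoc)
    also have "base g' * base (inverse g') = 1" using g'0 by (simp add: base_1 flip: base_mult)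
    finally have "\<psi> t2 = t2 * base (inverse g') + base (- f' * inverse g')"
      unfolding base_mult base_uminus by (simp add: algebra_simps)
    then show "inv\<^bsub>Cr2\<^esub> \<phi> \<in> translation_triangular"
      unfolding \<psi>_def[symmetric]
      by (rule translation_triangularI[OF \<psi> t1, rotated]) (simp add: g'0)
  next
    fix \<phi> \<psi> :: "'a ratfun2 \<Rightarrow> 'a ratfun2"
    assume "\<phi> \<in> translation_triangular" "\<psi> \<in> translation_triangular"
    then obtain k f g l f' g' where \<phi>: "\<phi> \<in> carrier Cr2" "\<phi> t1 = t1 + const2 k"
      "g \<noteq> 0" "\<phi> t2 = t2 * base g + base f" and \<psi>: "\<psi> \<in> carrier Cr2" "\<psi> t1 = t1 + const2 l"
      "g' \<noteq> 0" "\<psi> t2 = t2 * base g' + base f'" unfolding translation_triangular_def by blast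
    interpret h: field_hom \<psi> by (rule Cr2_field_hom[OF \<psi>(1)])
    obtain f1 g1 where f1: "\<psi> (base f) = base f1" and g1: "\<psi> (base g) = base g1"
      using translation_maps_base[OF \<psi>(1,2)] by metis
    have g10: "g1 \<noteq> 0"
      using injD[OF field_hom_inj[OF h.field_hom_axioms], of "base g" 0] g1 \<phi>(3) by auto
    have "\<psi> (\<phi> t1) = t1 + const2 (l + k)"
      using \<psi> by (simp add: \<phi> h.hom_add const2_add Cr2_def add.assoc)
    moreover have "\<psi> (\<phi> t2) = t2 * base (g' * g1) + base (f' * g1 + f1)"
      unfolding base_mult base_add by (simp add: \<phi> \<psi> h.hom_add h.hom_mult f1 g1 algebra_simps)
    moreover have "g' * g1 \<noteq> 0" using g10 \<psi>(3) by simp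
    ultimately show "\<phi> \<otimes>\<^bsub>Cr2\<^esub> \<psi> \<in> translation_triangular"
      using translation_triangularI[OF m_closed[OF \<phi>(1) \<psi>(1)]] unfolding Cr2_mult comp_apply by blast
  qed
qed

lemma subgroup_fixing:
  "subgroup {\<phi> \<in> carrier Cr2. \<phi> x = x} (Cr2 :: ('a::field ratfun2 \<Rightarrow> 'a ratfun2) monoid)"
proof -
  interpret group "Cr2 :: ('a ratfun2 \<Rightarrow> 'a ratfun2) monoid" by (rule group_Cr2)
  show ?thesis
  proof (rule subgroupI)
    have "\<one>\<^bsub>Cr2\<^esub> \<in> {\<phi> \<in> carrier (Cr2 :: ('a ratfun2 \<Rightarrow> 'a ratfun2) monoid). \<phi> x = x}"
      using one_closed by (simp add: Cr2_def)
    then show "{\<phi> \<in> carrier Cr2. \<phi> x = x} \<noteq> {}" by blast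
  next
    fix \<phi> assume "\<phi> \<in> {\<phi> \<in> carrier Cr2. \<phi> x = x}"
    then show "inv\<^bsub>Cr2\<^esub> \<phi> \<in> {\<phi> \<in> carrier Cr2. \<phi> x = x}"
      using Cr2_inv_apply[of \<phi> x] by simp
  next
    fix \<phi> \<psi> assume "\<phi> \<in> {\<phi> \<in> carrier Cr2. \<phi> x = x}" "\<psi> \<in> {\<phi> \<in> carrier Cr2. \<phi> x = x}"
    then show "\<phi> \<otimes>\<^bsub>Cr2\<^esub> \<psi> \<in> {\<phi> \<in> carrier Cr2. \<phi> x = x}"
      using m_closed[of \<phi> \<psi>] by (simp add: Cr2_mult)
  qed auto
qed

lemma fibrewise_affine_eq:
  "fibrewise_affine = translation_triangular \<inter> {\<phi> \<in> carrier Cr2. \<phi> t1 = t1}"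
proof -
  have "\<exists>k. \<phi> t1 = t1 + const2 k" if "\<phi> t1 = t1" for \<phi> :: "'a::field ratfun2 \<Rightarrow> 'a ratfun2"
    using that by (intro exI[of _ 0]) (simp add: const2_0)
  then show ?thesis unfolding fibrewise_affine_def translation_triangular_def by blast
qed

lemma subgroup_fibrewise_affine: "subgroup fibrewise_affine Cr2"
  unfolding fibrewise_affine_eq
  by (rule group.subgroups_Inter_pair[OF group_Cr2 subgroup_translation_triangular subgroup_fixing])

lemma subgroup_fibrewise_translations:
  "subgroup fibrewise_translations (Cr2 :: ('a::field ratfun2 \<Rightarrow> 'a ratfun2) monoid)"
proof -
  interpret group "Cr2 :: ('a ratfun2 \<Rightarrow> 'a ratfun2) monoid" by (rule group_Cr2)
  show ?thesis
  proof (rule subgroupI)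
    show "fibrewise_translations \<subseteq> carrier (Cr2 :: ('a ratfun2 \<Rightarrow> 'a ratfun2) monoid)"
      by (auto simp: fibrewise_translations_def)
    have "alpha 0 \<in> (fibrewise_translations :: ('a ratfun2 \<Rightarrow> 'a ratfun2) set)"
      using alpha_mem_Cr2 by (auto simp: fibrewise_translations_def alpha_values)
    then show "(fibrewise_translations :: ('a ratfun2 \<Rightarrow> 'a ratfun2) set) \<noteq> {}" by blast
  next
    fix \<phi> :: "'a ratfun2 \<Rightarrow> 'a ratfun2" assume "\<phi> \<in> fibrewise_translations"
    then obtain f where \<phi>: "\<phi> \<in> carrier Cr2" "\<phi> t1 = t1" "\<phi> t2 = t2 + base f"
      unfolding fibrewise_translations_def by blast
    define \<psi> where "\<psi> = inv\<^bsub>Cr2\<^esub> \<phi>"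
    have \<psi>: "\<psi> \<in> carrier Cr2" using \<phi>(1) by (simp add: \<psi>_def)
    interpret h: field_hom \<psi> by (rule Cr2_field_hom[OF \<psi>])
    note cancel = Cr2_inv_apply[OF \<phi>(1), folded \<psi>_def]
    have t1: "\<psi> t1 = t1" using cancel[of t1] \<phi>(2) by simp
    have "t2 = \<psi> t2 + base f"
      using cancel[of t2] by (simp add: \<phi>(3) h.hom_add fixes_t1_fixes_base[OF \<psi> t1])
    then have "\<psi> t2 + (base f + base (- f)) = t2 + base (- f)" by (simp only: add.assoc[symmetric])
    then have "\<psi> t2 = t2 + base (- f)" by (simp flip: base_add)
    then show "inv\<^bsub>Cr2\<^esub> \<phi> \<in> fibrewise_translations"
      unfolding fibrewise_translations_def \<psi>_def[symmetric] using \<psi> t1 by blast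
  next
    fix \<phi> \<psi> :: "'a ratfun2 \<Rightarrow> 'a ratfun2"
    assume "\<phi> \<in> fibrewise_translations" "\<psi> \<in> fibrewise_translations"
    then obtain f f' where \<phi>: "\<phi> \<in> carrier Cr2" "\<phi> t1 = t1" "\<phi> t2 = t2 + base f"
      and \<psi>: "\<psi> \<in> carrier Cr2" "\<psi> t1 = t1" "\<psi> t2 = t2 + base f'"
      unfolding fibrewise_translations_def by blast
    interpret h: field_hom \<psi> by (rule Cr2_field_hom[OF \<psi>(1)])
    have "\<psi> (\<phi> t2) = t2 + base (f' + f)"
      unfolding base_add by (simp add: \<phi> \<psi> h.hom_add fixes_t1_fixes_base[OF \<psi>(1,2)] add.assoc)
    then show "\<phi> \<otimes>\<^bsub>Cr2\<^esub> \<psi> \<in> fibrewise_translations"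
      unfolding fibrewise_translations_def using m_closed[OF \<phi>(1) \<psi>(1)] \<phi>(2) \<psi>(2) by (simp add: Cr2_mult)
  qed
qed


section \<open>Commutators of triangular transformations\<close>

lemma (in group) derived_subsetI:
  assumes "subgroup K G" and "\<And>x y. x \<in> H \<Longrightarrow> y \<in> H \<Longrightarrow> x \<otimes> y \<otimes> inv x \<otimes> inv y \<in> K"
  shows "derived G H \<subseteq> K"
  unfolding derived_def by (rule generate_subgroup_incl[OF _ assms(1)]) (use assms(2) in auto)

text \<open>This form is free of inverses on its right side: a commutator of transformations is
  found by comparing the two products at t1 and t2.\<close>

lemma (in group) commutator_mult:
  assumes "x \<in> carrier G" "y \<in> carrier G"
  shows "(x \<otimes> y \<otimes> inv x \<otimes> inv y) \<otimes> (y \<otimes> x) = x \<otimes> y"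
  using assms by (simp add: m_assoc inv_solve_left')

lemma (in group) commutator_in_subgroup:
  assumes "subgroup H G" "x \<in> H" "y \<in> H"
  shows "x \<otimes> y \<otimes> inv x \<otimes> inv y \<in> H"
  using assms by (intro subgroup.m_closed subgroup.m_inv_closed)

context
  fixes x y c :: "'a::field ratfun2 \<Rightarrow> 'a ratfun2"
  defines "c \<equiv> x \<otimes>\<^bsub>Cr2\<^esub> y \<otimes>\<^bsub>Cr2\<^esub> inv\<^bsub>Cr2\<^esub> x \<otimes>\<^bsub>Cr2\<^esub> inv\<^bsub>Cr2\<^esub> y"
begin

lemma commutator_apply:
  assumes "x \<in> carrier Cr2" "y \<in> carrier Cr2"
  shows "x (y (c r)) = y (x r)"
  using group.commutator_mult[OF group_Cr2 assms] by (simp add: c_def Cr2_mult fun_eq_iff)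

text \<open>The shifts of x add up under composition, so they cancel in a commutator, and t1 is
  fixed.\<close>

lemma commutator_translation_triangular:
  assumes x: "x \<in> translation_triangular" and y: "y \<in> translation_triangular"
  shows "c \<in> fibrewise_affine"
proof -
  have c: "c \<in> translation_triangular"
    unfolding c_def
    by (rule group.commutator_in_subgroup[OF group_Cr2 subgroup_translation_triangular x y])
  obtain k l m where k: "x \<in> carrier Cr2" "x t1 = t1 + const2 k" and l: "y \<in> carrier Cr2" "y t1 = t1 + const2 l"
    and m: "c \<in> carrier Cr2" "c t1 = t1 + const2 m"
    using x y c unfolding translation_triangular_def by blast
  interpret x: field_hom x by (rule Cr2_field_hom[OF k(1)])
  interpret y: field_hom y by (rule Cr2_field_hom[OF l(1)])
  have const: "x (const2 e) = const2 e" "y (const2 e) = const2 e" for e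
    using k(1) l(1) by (simp_all add: Cr2_def)
  have "const2 m = 0"
    using commutator_apply[OF k(1) l(1), of t1] by (simp add: k l m x.hom_add y.hom_add const)
  then have "c t1 = t1" using m by simp
  then show ?thesis using c m(1) by (simp add: fibrewise_affine_eq)
qed

text \<open>The coefficients of t2 multiply under composition, in a commutative group; comparing
  them shows that the commutator has coefficient 1.\<close>

lemma commutator_fibrewise_affine:
  assumes x: "x \<in> fibrewise_affine" and y: "y \<in> fibrewise_affine"
  shows "c \<in> fibrewise_translations"
proof -
  have "c \<in> fibrewise_affine"
    unfolding c_def
    by (rule group.commutator_in_subgroup[OF group_Cr2 subgroup_fibrewise_affine x y])
  then obtain f g where c: "c \<in> carrier Cr2" "c t1 = t1" "c t2 = t2 * base g + base f"
    unfolding fibrewise_affine_def by blast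
  obtain f1 g1 where x: "x \<in> carrier Cr2" "x t1 = t1" "g1 \<noteq> 0" "x t2 = t2 * base g1 + base f1"
    using x unfolding fibrewise_affine_def by blast
  obtain f2 g2 where y: "y \<in> carrier Cr2" "y t1 = t1" "g2 \<noteq> 0" "y t2 = t2 * base g2 + base f2"
    using y unfolding fibrewise_affine_def by blast
  interpret x: field_hom x by (rule Cr2_field_hom[OF x(1)])
  interpret y: field_hom y by (rule Cr2_field_hom[OF y(1)])
  have fixed: "x (base r) = base r" "y (base r) = base r" for r
    using fixes_t1_fixes_base[OF x(1,2)] fixes_t1_fixes_base[OF y(1,2)] by auto
  have "((t2 * base g1 + base f1) * base g2 + base f2) * base g + base f
      = (t2 * base g2 + base f2) * base g1 + base f1"
    using commutator_apply[OF x(1) y(1), of t2]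
    by (simp add: x(4) y(4) c(3) x.hom_add y.hom_add x.hom_mult y.hom_mult fixed)
  then have "t2 * base (g1 * g2 * g) + base (f1 * g2 * g + f2 * g + f)
      = t2 * base (g2 * g1) + base (f2 * g1 + f1)"
    unfolding base_mult base_add by (simp only: distrib_right mult.assoc add.assoc)
  then have "g1 * g2 * g = g2 * g1" by (simp only: affine_coeffs_unique)
  then have "g = 1" using x(3) y(3) by simp
  then show ?thesis using c by (auto simp: fibrewise_translations_def base_1)
qed

text \<open>Fibrewise translations compose by adding functions of x, so they commute.\<close>

lemma commutator_fibrewise_translations:
  assumes x: "x \<in> fibrewise_translations" and y: "y \<in> fibrewise_translations"
  shows "c = \<one>\<^bsub>Cr2\<^esub>"
proof -
  have "c \<in> fibrewise_translations"
    unfolding c_def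
    by (rule group.commutator_in_subgroup[OF group_Cr2 subgroup_fibrewise_translations x y])
  then obtain f where c: "c \<in> carrier Cr2" "c t1 = t1" "c t2 = t2 + base f"
    unfolding fibrewise_translations_def by blast
  obtain f1 where x: "x \<in> carrier Cr2" "x t1 = t1" "x t2 = t2 + base f1"
    using x unfolding fibrewise_translations_def by blast
  obtain f2 where y: "y \<in> carrier Cr2" "y t1 = t1" "y t2 = t2 + base f2"
    using y unfolding fibrewise_translations_def by blast
  interpret x: field_hom x by (rule Cr2_field_hom[OF x(1)])
  interpret y: field_hom y by (rule Cr2_field_hom[OF y(1)])
  have fixed: "x (base r) = base r" "y (base r) = base r" for r
    using fixes_t1_fixes_base[OF x(1,2)] fixes_t1_fixes_base[OF y(1,2)] by auto
  have "base f = 0"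
    using commutator_apply[OF x(1) y(1), of t2]
    by (simp add: x(3) y(3) c(3) x.hom_add y.hom_add fixed)
  then have "c t2 = t2" using c(3) by simp
  then show ?thesis
    by (intro Cr2_eqI[OF c(1) monoid.one_closed[OF group.is_monoid[OF group_Cr2]]])
      (simp_all add: c(2), simp_all add: Cr2_def)
qed

end

section \<open>The derived series of the generated group\<close>

lemma crem_gens_translation_triangular: "crem_gens \<subseteq> translation_triangular"
proof -
  have "shift 1 \<in> (translation_triangular :: (rat ratfun2 \<Rightarrow> rat ratfun2) set)"
    unfolding translation_triangular_def
  proof (intro CollectI conjI exI shift_mem_Cr2)
    show "shift 1 t1 = t1 + const2 1" by (simp add: shift_values)
    show "shift 1 t2 = t2 * base 1 + base 0" by (simp add: shift_values base_1)
  qed simp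
  moreover have "alpha 1 \<in> (translation_triangular :: (rat ratfun2 \<Rightarrow> rat ratfun2) set)"
    unfolding translation_triangular_def
  proof (intro CollectI conjI exI alpha_mem_Cr2)
    show "alpha 1 t1 = t1 + const2 0" by (simp add: alpha_values const2_0)
    show "alpha 1 t2 = t2 * base 1 + base 1" by (simp add: alpha_values base_1)
  qed simp
  moreover have "mu (to_fract [:0, 1:]) \<in> (translation_triangular :: (rat ratfun2 \<Rightarrow> rat ratfun2) set)"
    unfolding translation_triangular_def
  proof (intro CollectI conjI exI mu_mem_Cr2 X_nonzero)
    show "mu (to_fract [:0, 1:]) t1 = t1 + const2 (0::rat)"
      by (simp add: mu_values[OF X_nonzero] const2_0)
    show "mu (to_fract [:0, 1:]) t2 = t2 * base (to_fract [:0, 1 :: rat:]) + base 0"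
      by (simp add: mu_values[OF X_nonzero])
  qed (rule X_nonzero)
  ultimately show ?thesis by blast
qed

lemma crem_subset: "carrier crem_group \<subseteq> translation_triangular"
  by (rule Cr2.subgroup_generated_minimal[OF subgroup_translation_triangular crem_gens_translation_triangular])

lemma crem_subgroupI:
  assumes "subgroup K Cr2" shows "subgroup (K \<inter> carrier crem_group) crem_group"
  unfolding Cr2.subgroup_subgroup_generated_iff
  using Cr2.subgroups_Inter_pair[OF assms Cr2.subgroup_subgroup_generated] by blast

text \<open>Transfers commutator computations in the whole Cremona group to derived subgroups formed
  inside \<open>crem_group\<close>; products and inverses of its elements agree in the two
  groups.\<close>

lemma crem_derived_step:
  assumes K: "subgroup K Cr2" and H: "H \<subseteq> H' \<inter> carrier crem_group"
    and c: "\<And>x y. x \<in> H' \<Longrightarrow> y \<in> H' \<Longrightarrow>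
      x \<otimes>\<^bsub>Cr2\<^esub> y \<otimes>\<^bsub>Cr2\<^esub> inv\<^bsub>Cr2\<^esub> x \<otimes>\<^bsub>Cr2\<^esub> inv\<^bsub>Cr2\<^esub> y \<in> K"
  shows "derived crem_group H \<subseteq> K \<inter> carrier crem_group"
proof (rule crem.derived_subsetI[OF crem_subgroupI[OF K]])
  fix x y assume x: "x \<in> H" and y: "y \<in> H"
  then have xG: "x \<in> carrier crem_group" and yG: "y \<in> carrier crem_group" using H by auto
  have "x \<otimes>\<^bsub>crem_group\<^esub> y \<otimes>\<^bsub>crem_group\<^esub> inv\<^bsub>crem_group\<^esub> x \<otimes>\<^bsub>crem_group\<^esub> inv\<^bsub>crem_group\<^esub> y \<in> carrier crem_group"
    by (intro crem.m_closed crem.inv_closed xG yG)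
  moreover have "x \<otimes>\<^bsub>crem_group\<^esub> y \<otimes>\<^bsub>crem_group\<^esub> inv\<^bsub>crem_group\<^esub> x \<otimes>\<^bsub>crem_group\<^esub> inv\<^bsub>crem_group\<^esub> y \<in> K"
    using c[of x y] x y H by (auto simp: Cr2.inv_subgroup_generated[OF xG] Cr2.inv_subgroup_generated[OF yG])
  ultimately show "x \<otimes>\<^bsub>crem_group\<^esub> y \<otimes>\<^bsub>crem_group\<^esub> inv\<^bsub>crem_group\<^esub> x \<otimes>\<^bsub>crem_group\<^esub> inv\<^bsub>crem_group\<^esub> y \<in> K \<inter> carrier crem_group"
    by blast
qed

lemma crem_derived_3: "(derived crem_group ^^ 3) (carrier crem_group) = {\<one>\<^bsub>crem_group\<^esub>}"
proof -
  have 1: "derived crem_group (carrier crem_group) \<subseteq> fibrewise_affine \<inter> carrier crem_group"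
    by (rule crem_derived_step[OF subgroup_fibrewise_affine, of _ translation_triangular])
      (use crem_subset commutator_translation_triangular in auto)
  have 2: "derived crem_group (derived crem_group (carrier crem_group)) \<subseteq> fibrewise_translations \<inter> carrier crem_group"
    by (rule crem_derived_step[OF subgroup_fibrewise_translations 1])
      (rule commutator_fibrewise_affine)
  have "derived crem_group (derived crem_group (derived crem_group (carrier crem_group))) \<subseteq> {\<one>\<^bsub>Cr2\<^esub>} \<inter> carrier crem_group"
    by (rule crem_derived_step[OF Cr2.triv_subgroup 2])
      (simp add: commutator_fibrewise_translations)
  moreover have "(derived crem_group ^^ 3) (carrier crem_group) = derived crem_group (derived crem_group (derived crem_group (carrier crem_group)))"
    by (simp add: numeral_3_eq_3)
  moreover have "\<one>\<^bsub>crem_group\<^esub> \<in> (derived crem_group ^^ 3) (carrier crem_group)"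
    by (rule subgroup.one_closed[OF crem.exp_of_derived_is_subgroup[OF crem.subgroup_self]])
  ultimately show ?thesis by auto
qed

lemma (in group) commutator_eqI:
  assumes "x \<in> carrier G" "y \<in> carrier G" "w \<in> carrier G" and "x \<otimes> y = w \<otimes> y \<otimes> x"
  shows "x \<otimes> y \<otimes> inv x \<otimes> inv y = w"
  using assms by (simp add: m_assoc)

lemma (in group) commute_if_commutator_one:
  assumes "x \<in> carrier G" "y \<in> carrier G" and "x \<otimes> y \<otimes> inv x \<otimes> inv y = \<one>"
  shows "x \<otimes> y = y \<otimes> x"
  using commutator_mult[OF assms(1,2)] assms by simp

lemma crem_derived_2: "(derived crem_group ^^ 2) (carrier crem_group) \<noteq> {\<one>\<^bsub>crem_group\<^esub>}"
proof
  assume trivial: "(derived crem_group ^^ 2) (carrier crem_group) = {\<one>\<^bsub>crem_group\<^esub>}"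
  let ?X = "to_fract [:0, 1 :: rat:]" and ?Y = "to_fract [:1, 1 :: rat:]"
  let ?s = "shift 1 :: rat ratfun2 \<Rightarrow> rat ratfun2" and ?m = "mu ?X"
    and ?a = "alpha 1 :: rat ratfun2 \<Rightarrow> rat ratfun2"
  have G: "?s \<in> carrier crem_group" "?m \<in> carrier crem_group" "?a \<in> carrier crem_group" using crem_gens_crem by auto
  have C: "?s \<in> carrier Cr2" "?m \<in> carrier Cr2" "?a \<in> carrier Cr2" using crem_gens_subset by auto
  have comm: "x \<otimes>\<^bsub>Cr2\<^esub> y \<otimes>\<^bsub>Cr2\<^esub> inv\<^bsub>Cr2\<^esub> x \<otimes>\<^bsub>Cr2\<^esub> inv\<^bsub>Cr2\<^esub> y \<in> derived crem_group H"
    if "x \<in> H" "y \<in> H" "H \<subseteq> carrier crem_group" for x y H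
  proof -
    have "x \<in> carrier crem_group" "y \<in> carrier crem_group" using that by auto
    note inv = this[THEN Cr2.inv_subgroup_generated]
    have "x \<otimes>\<^bsub>crem_group\<^esub> y \<otimes>\<^bsub>crem_group\<^esub> inv\<^bsub>crem_group\<^esub> x \<otimes>\<^bsub>crem_group\<^esub> inv\<^bsub>crem_group\<^esub> y \<in> derived crem_group H"
      unfolding derived_def using that by (intro generate.incl) blast
    then show ?thesis by (simp add: inv)
  qed
  \<comment> \<open>\<open>mu u\<close> is the commutator of the inverse shift with the generator
    \<open>?m\<close>, because shifting replaces X by X + 1.\<close>
  define u where "u = ?Y / ?X"
  \<comment> \<open>\<open>alpha v\<close> is the commutator of \<open>?m\<close> and
    \<open>?a\<close>: conjugation turns \<alpha> at 1 into \<alpha> at X, that is, at v +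
    1.\<close>
  define v where "v = ?X - 1"
  have X0: "?X \<noteq> 0" and Y0: "?Y \<noteq> 0" by simp_all
  have u: "u \<noteq> 0" "u * ?X = ?Y" unfolding u_def using X0 Y0 by (simp_all only: divide_eq_0_iff) auto
  have muC: "mu u \<in> carrier Cr2" by (rule mu_mem_Cr2[OF u(1)])
  have alphaC: "alpha v \<in> carrier Cr2" by (rule alpha_mem_Cr2)
  have "?m \<otimes>\<^bsub>Cr2\<^esub> ?s = ?s \<otimes>\<^bsub>Cr2\<^esub> mu ?Y"
    using mu_shift[of "[:0, 1:]" "1 :: rat"] by simp
  also have "mu ?Y = mu u \<otimes>\<^bsub>Cr2\<^esub> ?m"
    using mu_mult[OF u(1) X0] u(2) by simp
  finally have "inv\<^bsub>Cr2\<^esub> ?s \<otimes>\<^bsub>Cr2\<^esub> (?m \<otimes>\<^bsub>Cr2\<^esub> ?s) = mu u \<otimes>\<^bsub>Cr2\<^esub> ?m"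
    using C muC by (simp flip: Cr2.m_assoc)
  then have "inv\<^bsub>Cr2\<^esub> ?s \<otimes>\<^bsub>Cr2\<^esub> ?m = mu u \<otimes>\<^bsub>Cr2\<^esub> ?m \<otimes>\<^bsub>Cr2\<^esub> inv\<^bsub>Cr2\<^esub> ?s"
    using C muC by (simp add: Cr2.inv_solve_right flip: Cr2.m_assoc)
  from Cr2.commutator_eqI[OF Cr2.inv_closed[OF C(1)] C(2) muC this]
  have mu_D: "mu u \<in> derived crem_group (carrier crem_group)"
    using comm[OF crem.inv_closed[OF G(1)] G(2) order_refl] by (simp add: Cr2.inv_subgroup_generated[OF G(1)])
  have "?m \<otimes>\<^bsub>Cr2\<^esub> ?a = alpha (v + 1) \<otimes>\<^bsub>Cr2\<^esub> ?m"
    using mu_alpha[OF X0, of 1] by (simp add: v_def)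
  then have "?m \<otimes>\<^bsub>Cr2\<^esub> ?a = alpha v \<otimes>\<^bsub>Cr2\<^esub> ?a \<otimes>\<^bsub>Cr2\<^esub> ?m" by (simp only: alpha_add)
  from Cr2.commutator_eqI[OF C(2,3) alphaC this]
  have alpha_D: "alpha v \<in> derived crem_group (carrier crem_group)"
    using comm[OF G(2,3) order_refl] by simp
  have "mu u \<otimes>\<^bsub>Cr2\<^esub> alpha v \<otimes>\<^bsub>Cr2\<^esub> inv\<^bsub>Cr2\<^esub> (mu u) \<otimes>\<^bsub>Cr2\<^esub> inv\<^bsub>Cr2\<^esub> (alpha v) = \<one>\<^bsub>Cr2\<^esub>"
    using comm[OF mu_D alpha_D crem.derived_in_carrier[OF order_refl]] trivial
    by (simp add: numeral_2_eq_2)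
  then have "mu u \<otimes>\<^bsub>Cr2\<^esub> alpha v = alpha v \<otimes>\<^bsub>Cr2\<^esub> mu u"
    by (rule Cr2.commute_if_commutator_one[OF muC alphaC])
  then have "alpha (v * u) \<otimes>\<^bsub>Cr2\<^esub> mu u = alpha v \<otimes>\<^bsub>Cr2\<^esub> mu u"
    by (simp only: mu_alpha[OF u(1)])
  then have "alpha (v * u) = alpha v"
    using muC by (simp only: Cr2.right_cancel alpha_mem_Cr2)
  then have "t2 + base (v * u) = t2 + base v" by (metis alpha_values(2))
  then have "v * u = v" by (simp only: add_left_cancel base_eq_iff)
  \<comment> \<open>Either v = 0, which means X = 1, or u = 1, which means X + 1 = X.\<close>
  then have "?X = to_fract 1 \<or> ?Y = ?X" using u(2) by (auto simp: v_def)
  then show False by (simp add: one_pCons del: to_fract_1)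
qed

lemma crem_derived_length: "derived_length crem_group = 3"
  unfolding derived_length_def
proof (rule Least_equality)
  show "(derived crem_group ^^ 3) (carrier crem_group) = {\<one>\<^bsub>crem_group\<^esub>}" by (rule crem_derived_3)
next
  fix n assume n: "(derived crem_group ^^ n) (carrier crem_group) = {\<one>\<^bsub>crem_group\<^esub>}"
  \<comment> \<open>The derived series decreases, so a trivial term with index at most 2 would make
    the second derived subgroup trivial.\<close>
  have dec: "(derived crem_group ^^ Suc k) (carrier crem_group) \<subseteq> (derived crem_group ^^ k) (carrier crem_group)" for k
    using crem.derived_incl[OF order_refl crem.exp_of_derived_is_subgroup[OF crem.subgroup_self]] by simp
  show "3 \<le> n"
  proof (rule ccontr)
    assume "\<not> 3 \<le> n"
    then have "n \<le> 2" by simp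
    then have "(derived crem_group ^^ 2) (carrier crem_group) \<subseteq> {\<one>\<^bsub>crem_group\<^esub>}"
      using lift_Suc_antimono_le[of "\<lambda>k. (derived crem_group ^^ k) (carrier crem_group)", OF dec, of n 2] n by simp
    moreover have "\<one>\<^bsub>crem_group\<^esub> \<in> (derived crem_group ^^ 2) (carrier crem_group)"
      by (rule subgroup.one_closed[OF crem.exp_of_derived_is_subgroup[OF crem.subgroup_self]])
    ultimately show False using crem_derived_2 by blast
  qed
qed

theorem proposition2p2:
  fixes G :: "(rat ratfun2 \<Rightarrow> rat ratfun2) monoid"
  defines "G \<equiv> subgroup_generated Cr2 {shift 1, alpha 1, mu (to_fract [:0, 1:])}"
  shows "finitely_generated G \<and> solvable G \<and> derived_length G = 3
    \<and> \<not> linear_over TYPE('f::field) G"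
  unfolding G_def
  using crem_finitely_generated crem.solvable_iff_trivial_derived_seq crem_derived_3 crem_derived_length
    crem_not_linear by blast

end
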